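(* Let $\Bbbk$ be a field of characteristic zero, let $n\ge2$, $I_n=\{1,\dots,n\}$, let $p:I_n\to\mathbb{Z}_2$ be any function, $p_{ij}:=p(i)+p(j)$, and let $F_{\mathbf{q}}^{\mathrm{int}}[ML_n^p]$ be the $\Bbbk[q^{\pm1},\mathbf{q}^{\pm1}]$-superalgebra defined in the context. Fix any total order on the set of generators $\{x_{ij}\mid i,j\in I_n\}$. Then the set $$\mathbb{B}:=\Big\{\overrightarrow{\prod_{i,j\in I_n}}x_{ij}^{e_{ij}}\ \Big|\ e_{ij}\in\mathbb{N}\ \forall\,i,j\in I_n,\ \ e_{ij}\le1\text{ if }p_{ij}=\bar1\Big\}$$ of all truncated ordered monomials in the $x_{ij}$ (factors multiplied in the fixed order) is a $\Bbbk[q^{\pm1},\mathbf{q}^{\pm1}]$-basis of the $\Bbbk[q^{\pm1},\mathbf{q}^{\pm1}]$-module $F_{\mathbf{q}}^{\mathrm{int}}[ML_n^p]$. In particular, $F_{\mathbf{q}}^{\mathrm{int}}[ML_n^p]$ is a free $\Bbbk[q^{\pm1},\mathbf{q}^{\pm1}]$-module. Likewise, $\mathbb{B}$ is a $\Bbbk(q,\mathbf{q})$-basis of $F_{\mathbf{q}}[ML_n^p]:=\Bbbk(q,\mathbf{q})\otimes_{\Bbbk[q^{\pm1},\mathbf{q}^{\pm1}]}F_{\mathbf{q}}^{\mathrm{int}}[ML_n^p]$.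
   Context: $\mathbb{N}$ includes $0$; $\mathbb{Z}_2=\{\bar0,\bar1\}$. Parameters: $q$ and $q_{i,j}$ ($1\le i<j\le n$) are independent indeterminates, and the matrix $\mathbf{q}=(q_{i,j})_{i,j\in I_n}$ is multiplicatively antisymmetric, i.e. $q_{i,i}:=1$ and $q_{j,i}:=q_{i,j}^{-1}$ for $i<j$. Then $\Bbbk[q^{\pm1},\mathbf{q}^{\pm1}]$ is the $\Bbbk$-algebra of Laurent polynomials in $q$ and the $q_{i,j}$ ($i<j$), with field of fractions $\Bbbk(q,\mathbf{q})$. Put $q_s:=q^{(-1)^{p(s)}}$ for $s\in I_n$ (single index, not to be confused with $q_{i,j}$). The superalgebra $F_{\mathbf{q}}^{\mathrm{int}}[ML_n^p]$ is the unital associative $\Bbbk[q^{\pm1},\mathbf{q}^{\pm1}]$-superalgebra generated by $\{x_{ij}\mid i,j\in I_n\}$, with parity $|x_{ij}|=p_{ij}$, subject to the relations $$x_{ij}^2=0\quad(p_{ij}=\bar1),$$ $$x_{ij}x_{ik}=(-1)^{p_{ij}p_{ik}}\,q_i\,q_{j,k}^{-1}\,x_{ik}x_{ij}\quad(j<k),$$ $$x_{ij}x_{hj}=(-1)^{p_{ij}p_{hj}}\,q_j\,q_{i,h}\,x_{hj}x_{ij}\quad(i<h),$$ $$x_{ij}x_{hk}=(-1)^{p_{ij}p_{hk}}\,q_{i,h}\,q_{j,k}^{-1}\,x_{hk}x_{ij}\quad(i<h,\ j>k),$$ $$x_{ij}x_{hk}=(-1)^{p_{ij}p_{hk}}\,q_{i,h}\,q_{j,k}^{-1}\,x_{hk}x_{ij}+(-1)^{p_{ij}p_{ik}}\,(q_i-q_i^{-1})\,q_{j,k}^{-1}\,x_{ik}x_{hj}\quad(i<h,\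 j<k).$$ *)

theory Defs
  imports
    "Jordan_Normal_Form.Missing_VectorSpace"
    "HOL-Algebra.QuotRing"
    "HOL-Algebra.Free_Abelian_Groups"
    "HOL-Algebra.Algebraic_Closure_Type"
    "HOL-Computational_Algebra.Fraction_Field"
    "HOL-Library.Poly_Mapping"
    "HOL-Library.Option_ord"
    "HOL-Library.Product_Lexorder"
    "HOL-Library.Cardinality"
    "HOL-Library.Z2"
begin

text \<open>
  The index set $I_n$ is the universe of a finite linearly ordered type \<open>'n\<close>, and
  $n$ is \<open>CARD('n)\<close>. The group $Z_2$ is the library type \<^typ>\<open>bit\<close>.
\<close>

section \<open>Laurent polynomials and their field of fractions\<close>

text \<open>
  The indeterminates: \<open>None\<close> stands for $q$, and \<open>Some (i, j)\<close> with $i < j$ stands for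
  $q_{i,j}$.
\<close>

typedef (overloaded) ('n::linorder) qvar = "{None} \<union> Some ` {(i, j). i < (j::'n)}"
  by blast

text \<open>
  The order on indeterminates is irrelevant; it is only there because the library needs
  ordered exponents to make the Laurent polynomials an instance of \<^class>\<open>idom\<close>.
\<close>

instantiation qvar :: (linorder) linorder
begin

definition less_eq_qvar :: "'a qvar \<Rightarrow> 'a qvar \<Rightarrow> bool"
  where "v \<le> w \<longleftrightarrow> Rep_qvar v \<le> Rep_qvar w"

definition less_qvar :: "'a qvar \<Rightarrow> 'a qvar \<Rightarrow> bool"
  where "v < w \<longleftrightarrow> Rep_qvar v < Rep_qvar w"

instance
  by standard (auto simp: less_eq_qvar_def less_qvar_def less_le_not_le simp flip: Rep_qvar_inject)

end

text \<open>
  Laurent polynomials are the group algebra of the free abelian group on the indeterminates.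
\<close>

type_synonym ('n, 'k) laurent = "('n qvar \<Rightarrow>\<^sub>0 int) \<Rightarrow>\<^sub>0 'k"

definition var_pow :: "'n::linorder qvar \<Rightarrow> int \<Rightarrow> ('n, 'k::field_char_0) laurent"
  where "var_pow v z = Poly_Mapping.single (Poly_Mapping.single v z) 1"

definition sgn_bit :: "bit \<Rightarrow> 'a::ring_1"
  where "sgn_bit b = (if b = 1 then - 1 else 1)"

text \<open>$q_s^z$, where $q_s = q^{(-1)^{p(s)}}$.\<close>

definition q1_pow :: "('n \<Rightarrow> bit) \<Rightarrow> 'n \<Rightarrow> int \<Rightarrow> ('n::linorder, 'k::field_char_0) laurent"
  where "q1_pow p s z = var_pow (Abs_qvar None) (sgn_bit (p s) * z)"

text \<open>$q_{i,j}^z$ for the entries of the multiplicatively antisymmetric matrix.\<close>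

definition q2_pow :: "'n \<Rightarrow> 'n \<Rightarrow> int \<Rightarrow> ('n::linorder, 'k::field_char_0) laurent"
  where "q2_pow i j z =
    (if i < j then var_pow (Abs_qvar (Some (i, j))) z
     else if j < i then var_pow (Abs_qvar (Some (j, i))) (- z)
     else 1)"

definition laurent_ring :: "'n::linorder itself \<Rightarrow> 'k::field_char_0 itself \<Rightarrow> ('n, 'k) laurent ring"
  where "laurent_ring _ _ = ring_of_type_algebra"

definition laurent_field ::
    "'n::linorder itself \<Rightarrow> 'k::field_char_0 itself \<Rightarrow> ('n, 'k) laurent fract ring"
  where "laurent_field _ _ = ring_of_type_algebra"

definition laurent_emb :: "('n::linorder, 'k::field_char_0) laurent \<Rightarrow> ('n, 'k) laurent fract"
  where "laurent_emb a = Fraction_Field.Fract a 1"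


section \<open>Free algebras\<close>

text \<open>
  Words form the free monoid, written additively because \<^typ>\<open>'a \<Rightarrow>\<^sub>0 'b\<close> turns an additive
  monoid of exponents into its monoid algebra.
\<close>

datatype 'a wd = Wd (letters: "'a list")

instantiation wd :: (type) monoid_add
begin

definition zero_wd :: "'a wd" where "0 = Wd []"

definition plus_wd :: "'a wd \<Rightarrow> 'a wd \<Rightarrow> 'a wd" where "v + w = Wd (letters v @ letters w)"

instance
  by standard (simp_all add: zero_wd_def plus_wd_def)

end

type_synonym ('g, 'r) free_alg = "'g wd \<Rightarrow>\<^sub>0 'r"

definition fa_gen :: "'g \<Rightarrow> ('g, 'r::comm_ring_1) free_alg"
  where "fa_gen g = Poly_Mapping.single (Wd [g]) 1"

definition fa_const :: "'r \<Rightarrow> ('g, 'r::comm_ring_1) free_alg"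
  where "fa_const c = Poly_Mapping.single 0 c"


section \<open>The multiparametric quantum matrix superalgebra\<close>

text \<open>
  \<open>part M a\<close> is the homogeneous component of parity \<open>a\<close>.
\<close>

record ('r, 'a) superalgebra = "('r, 'a) module" +
  part :: "bit \<Rightarrow> 'a set"

type_synonym ('n, 'k) mat_free_alg = "('n \<times> 'n, ('n, 'k) laurent) free_alg"

definition par :: "('n \<Rightarrow> bit) \<Rightarrow> 'n \<Rightarrow> 'n \<Rightarrow> bit"
  where "par p i j = p i + p j"

definition wd_par :: "('n \<Rightarrow> bit) \<Rightarrow> ('n \<times> 'n) wd \<Rightarrow> bit"
  where "wd_par p w = (\<Sum>(i, j) \<leftarrow> letters w. par p i j)"

definition mat_rels :: "('n \<Rightarrow> bit) \<Rightarrow> ('n::linorder, 'k::field_char_0) mat_free_alg set"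
  where "mat_rels p =
    (let x = (\<lambda>i j. fa_gen (i, j)); c = fa_const in
       {x i j * x i j | i j. par p i j = 1}
     \<union> {x i j * x i k
          - c (sgn_bit (par p i j * par p i k) * q1_pow p i 1 * q2_pow j k (-1)) * (x i k * x i j)
        | i j k. j < k}
     \<union> {x i j * x h j
          - c (sgn_bit (par p i j * par p h j) * q1_pow p j 1 * q2_pow i h 1) * (x h j * x i j)
        | i j h. i < h}
     \<union> {x i j * x h k
          - c (sgn_bit (par p i j * par p h k) * q2_pow i h 1 * q2_pow j k (-1)) * (x h k * x i j)
        | i j h k. i < h \<and> j > k}
     \<union> {x i j * x h k
          - (c (sgn_bit (par p i j * par p h k) * q2_pow i h 1 * q2_pow j k (-1)) * (x h k * x i j)
             + c (sgn_bit (par p i j * par p i k) * (q1_pow p i 1 - q1_pow p i (-1)) * q2_pow j k (-1))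
               * (x i k * x h j))
        | i j h k. i < h \<and> j < k})"

definition mat_ideal :: "('n \<Rightarrow> bit) \<Rightarrow> ('n::linorder, 'k::field_char_0) mat_free_alg set"
  where "mat_ideal p = Idl\<^bsub>ring_of_type_algebra\<^esub> (mat_rels p)"

text \<open>
  The relations are homogeneous, so the superalgebra they present is the quotient of the free
  algebra, graded by the parity of words, by the two-sided ideal they generate.
\<close>

definition F_int ::
    "'k::field_char_0 itself \<Rightarrow> ('n::linorder \<Rightarrow> bit)
      \<Rightarrow> (('n, 'k) laurent, ('n, 'k) mat_free_alg set) superalgebra"
  where "F_int _ p =
    (let A = ring_of_type_algebra; I = mat_ideal p; Q = A Quot I in
      \<lparr>carrier = carrier Q, monoid.mult = monoid.mult Q, one = \<one>\<^bsub>Q\<^esub>,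
       ring.zero = \<zero>\<^bsub>Q\<^esub>, add = add Q,
       module.smult = (\<lambda>c u. (I +>\<^bsub>A\<^esub> fa_const c) \<otimes>\<^bsub>Q\<^esub> u),
       part = (\<lambda>a. {I +>\<^bsub>A\<^esub> f | f. \<forall>w \<in> Poly_Mapping.keys f. wd_par p w = a})\<rparr>)"

definition F_gen ::
    "'k::field_char_0 itself \<Rightarrow> ('n::linorder \<Rightarrow> bit) \<Rightarrow> 'n \<times> 'n \<Rightarrow> ('n, 'k) mat_free_alg set"
  where "F_gen _ p g = mat_ideal p +>\<^bsub>ring_of_type_algebra\<^esub> fa_gen g"


section \<open>Truncated ordered monomials\<close>

text \<open>The elements of a finite type, listed increasingly with respect to \<open>r\<close>.\<close>

definition order_list :: "('g \<times> 'g) set \<Rightarrow> 'g list"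
  where "order_list r =
    (THE gs. distinct gs \<and> set gs = UNIV \<and> sorted_wrt (\<lambda>a b. (a, b) \<in> r) gs)"

lemma order_list_correct:
  fixes r :: "('g::finite \<times> 'g) set"
  assumes "linear_order r"
  shows "distinct (order_list r) \<and> set (order_list r) = UNIV
    \<and> sorted_wrt (\<lambda>a b. (a, b) \<in> r) (order_list r)"
proof -
  have tot: "(a,b) \<in> r \<or> (b,a) \<in> r" for a b
    using assms by (cases "a = b") (auto simp: order_on_defs total_on_def refl_on_def)
  have tr: "(a,b) \<in> r \<Longrightarrow> (b,c) \<in> r \<Longrightarrow> (a,c) \<in> r" for a b c
    using assms by (auto simp: order_on_defs dest: transD)
  have as: "(a,b) \<in> r \<Longrightarrow> (b,a) \<in> r \<Longrightarrow> a = b" for a b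
    using assms by (auto simp: order_on_defs dest: antisymD)
  interpret L: linorder "\<lambda>a b. (a,b) \<in> r" "\<lambda>a b. (a,b) \<in> r \<and> a \<noteq> b"
    by standard (use tot tr as in blast)+
  show ?thesis unfolding order_list_def
    by (rule theI2[where a = "L.sorted_list_of_set UNIV"])
       (auto simp: L.sorted_list_of_set.sorted_sorted_key_list_of_set intro: L.sorted_distinct_set_unique)
qed

definition ordered_monomial ::
    "'k::field_char_0 itself \<Rightarrow> ('n::{finite, linorder} \<Rightarrow> bit) \<Rightarrow> (('n \<times> 'n) \<times> ('n \<times> 'n)) set
      \<Rightarrow> ('n \<times> 'n \<Rightarrow> nat) \<Rightarrow> ('n, 'k) mat_free_alg set"
  where "ordered_monomial T p r e =
    foldr (\<lambda>g m. (F_gen T p g [^]\<^bsub>F_int T p\<^esub> e g) \<otimes>\<^bsub>F_int T p\<^esub> m) (order_list r) \<one>\<^bsub>F_int T p\<^esub>"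

definition truncated_exponents :: "('n \<Rightarrow> bit) \<Rightarrow> ('n \<times> 'n \<Rightarrow> nat) set"
  where "truncated_exponents p = {e. \<forall>i j. par p i j = 1 \<longrightarrow> e (i, j) \<le> 1}"

definition truncated_monomials ::
    "'k::field_char_0 itself \<Rightarrow> ('n::{finite, linorder} \<Rightarrow> bit) \<Rightarrow> (('n \<times> 'n) \<times> ('n \<times> 'n)) set
      \<Rightarrow> ('n, 'k) mat_free_alg set set"
  where "truncated_monomials T p r = ordered_monomial T p r ` truncated_exponents p"


section \<open>Bases of modules\<close>

definition module_basis :: "('r, 'x) ring_scheme \<Rightarrow> ('r, 'a, 'y) module_scheme \<Rightarrow> 'a set \<Rightarrow> bool"
  where "module_basis R M B \<longleftrightarrow>
    Module.module R M \<and> B \<subseteq> carrier M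
      \<and> \<not> LinearCombinations.module.lin_dep R M B
      \<and> LinearCombinations.module.span R M B = carrier M"

definition free_module :: "('r, 'x) ring_scheme \<Rightarrow> ('r, 'a, 'y) module_scheme \<Rightarrow> bool"
  where "free_module R M \<longleftrightarrow> (\<exists>B. module_basis R M B)"


section \<open>Extension of scalars\<close>

text \<open>
  For a ring homomorphism \<open>h\<close> from \<open>R\<close> to \<open>K\<close>, the tensor product of \<open>K\<close> and \<open>M\<close> over \<open>R\<close> is
  the free abelian group on the pairs of \<open>K \<times> M\<close> modulo the usual relations.
\<close>

abbreviation tensor_free ::
    "('b, 'x) ring_scheme \<Rightarrow> ('r, 'a, 'z) module_scheme \<Rightarrow> ('b \<times> 'a \<Rightarrow>\<^sub>0 int) monoid"
  where "tensor_free K M \<equiv> free_Abelian_group (carrier K \<times> carrier M)"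

definition tensor_rels ::
    "('r, 'x) ring_scheme \<Rightarrow> ('b, 'y) ring_scheme \<Rightarrow> ('r \<Rightarrow> 'b) \<Rightarrow> ('r, 'a, 'z) module_scheme
      \<Rightarrow> ('b \<times> 'a \<Rightarrow>\<^sub>0 int) set"
  where "tensor_rels R K h M =
      {frag_of (a \<oplus>\<^bsub>K\<^esub> b, m) - frag_of (a, m) - frag_of (b, m)
       | a b m. a \<in> carrier K \<and> b \<in> carrier K \<and> m \<in> carrier M}
    \<union> {frag_of (a, m \<oplus>\<^bsub>M\<^esub> l) - frag_of (a, m) - frag_of (a, l)
       | a m l. a \<in> carrier K \<and> m \<in> carrier M \<and> l \<in> carrier M}
    \<union> {frag_of (a \<otimes>\<^bsub>K\<^esub> h c, m) - frag_of (a, c \<odot>\<^bsub>M\<^esub> m)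
       | a c m. a \<in> carrier K \<and> c \<in> carrier R \<and> m \<in> carrier M}"

definition tensor_kernel ::
    "('r, 'x) ring_scheme \<Rightarrow> ('b, 'y) ring_scheme \<Rightarrow> ('r \<Rightarrow> 'b) \<Rightarrow> ('r, 'a, 'z) module_scheme
      \<Rightarrow> ('b \<times> 'a \<Rightarrow>\<^sub>0 int) set"
  where "tensor_kernel R K h M = generate (tensor_free K M) (tensor_rels R K h M)"

definition pure_tensor ::
    "('r, 'x) ring_scheme \<Rightarrow> ('b, 'y) ring_scheme \<Rightarrow> ('r \<Rightarrow> 'b) \<Rightarrow> ('r, 'a, 'z) module_scheme
      \<Rightarrow> 'b \<Rightarrow> 'a \<Rightarrow> ('b \<times> 'a \<Rightarrow>\<^sub>0 int) set"
  where "pure_tensor R K h M a m = tensor_kernel R K h M #>\<^bsub>tensor_free K M\<^esub> frag_of (a, m)"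

text \<open>
  Multiplication and the action of \<open>K\<close> are induced by
  $(a \otimes m)(b \otimes l) = ab \otimes ml$ and $a (b \otimes m) = ab \otimes m$; there are no
  signs because \<open>K\<close> is purely even.
\<close>

definition scalar_ext ::
    "('r, 'x) ring_scheme \<Rightarrow> ('b, 'y) ring_scheme \<Rightarrow> ('r \<Rightarrow> 'b) \<Rightarrow> ('r, 'a) superalgebra
      \<Rightarrow> ('b, ('b \<times> 'a \<Rightarrow>\<^sub>0 int) set) superalgebra"
  where "scalar_ext R K h M =
    (let G = tensor_free K M; N = tensor_kernel R K h M in
      \<lparr>carrier = carrier (G Mod N),
       monoid.mult = (\<lambda>u v. \<Union>f \<in> u. \<Union>g \<in> v.
         N #>\<^bsub>G\<^esub> frag_extend
           (\<lambda>(a, m). frag_extend (\<lambda>(b, l). frag_of (a \<otimes>\<^bsub>K\<^esub> b, m \<otimes>\<^bsub>M\<^esub> l)) g) f),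
       one = pure_tensor R K h M \<one>\<^bsub>K\<^esub> \<one>\<^bsub>M\<^esub>,
       ring.zero = one (G Mod N),
       add = monoid.mult (G Mod N),
       module.smult = (\<lambda>a u. \<Union>f \<in> u. N #>\<^bsub>G\<^esub> frag_extend (\<lambda>(b, m). frag_of (a \<otimes>\<^bsub>K\<^esub> b, m)) f),
       part = (\<lambda>s. {N #>\<^bsub>G\<^esub> f | f. Poly_Mapping.keys f \<subseteq> carrier K \<times> part M s})\<rparr>)"

definition F_frac ::
    "'k::field_char_0 itself \<Rightarrow> ('n::linorder \<Rightarrow> bit)
      \<Rightarrow> (('n, 'k) laurent fract,
          (('n, 'k) laurent fract \<times> ('n, 'k) mat_free_alg set \<Rightarrow>\<^sub>0 int) set) superalgebra"
  where "F_frac T p = scalar_ext (laurent_ring TYPE('n) T) (laurent_field TYPE('n) T) laurent_emb (F_int T p)"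

definition F_base ::
    "'k::field_char_0 itself \<Rightarrow> ('n::linorder \<Rightarrow> bit) \<Rightarrow> ('n, 'k) mat_free_alg set
      \<Rightarrow> (('n, 'k) laurent fract \<times> ('n, 'k) mat_free_alg set \<Rightarrow>\<^sub>0 int) set"
  where "F_base T p m =
    pure_tensor (laurent_ring TYPE('n) T) (laurent_field TYPE('n) T) laurent_emb (F_int T p) 1 m"

end

theory Submission
  imports Defs
begin

text \<open>
  Put $Q_i = (-1)^{p(i)} q_i$ and $\<lambda> = q - q^{-1}$. Every $Q_i$ is a root of
  $Q^2 = 1 + \<lambda> Q$, and $x_{ij}$ is odd iff $Q_i \<noteq> Q_j$ iff $Q_i Q_j = -1$. Up to a twist
  by scalars, which absorbs the $q_{i,j}$ and the remaining signs, the relations become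
  $x_{ij} x_{ik} = Q_i x_{ik} x_{ij}$ for $j < k$, $x_{ij} x_{hj} = Q_j x_{hj} x_{ij}$ for $i < h$,
  $x_{ij} x_{hk} = x_{hk} x_{ij}$ for $i < h$, $j > k$, and
  $x_{ij} x_{hk} = x_{hk} x_{ij} + \<lambda> x_{ik} x_{hj}$ for $i < h$, $j < k$, together with
  $x_{ij}^2 = 0$ for odd $x_{ij}$. An action of this algebra on functions of exponents is built by
  adjoining the generators one at a time, in decreasing lexicographic order. When $x_{ij}$ is
  adjoined, it acts by raising its own exponent, and $x_{hk}$ with $i < h$, $j < k$ is replaced by
  $x_{hk} + D x_{ik} x_{hj}$, where $D$ lowers the exponent of $x_{ij}$; this reverses Cauchon's
  deletion of derivations.

  Give $x_{ij}$ the weight $(i - 1) (j - 1)$. Then the last summand of the last relation has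
  smaller weight than the other two. Hence, for every order of the generators, words can be sorted
  modulo words of smaller weight, so that the ordered monomials span; and applied to the vacuum
  vector, the ordered monomial with exponents $e$ gives a unit at $e$ and $0$ at all other truncated
  exponents whose weight is at least that of $e$, so that the ordered monomials are independent. The
  functionals witnessing this extend to the tensor product with the field of fractions.
\<close>

section \<open>Adjoining a generator\<close>

text \<open>\<open>Q_sq\<close> is the Hecke quadratic (Q - q)(Q + q^-1) = 0 with \<open>lam\<close>
  in the place of q - q^-1; in the application an even index has the root q and an odd one the root
  - q^-1.\<close>

locale hecke_algebra =
  fixes sc :: "'k::comm_ring_1 \<Rightarrow> 'a::ring_1 \<Rightarrow> 'a" (infixr "\<star>" 75)
    and Q :: "'n::linorder \<Rightarrow> 'k" and lam :: 'k and p :: "'n \<Rightarrow> bit"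
  assumes sc_add_right: "c \<star> (x + y) = c \<star> x + c \<star> y"
    and sc_add_left: "(c + d) \<star> x = c \<star> x + d \<star> x"
    and sc_sc: "c \<star> d \<star> x = (c * d) \<star> x"
    and sc_one: "1 \<star> x = x"
    and sc_mult_left: "(c \<star> x) * y = c \<star> (x * y)"
    and sc_mult_right: "x * (c \<star> y) = c \<star> (x * y)"
    and Q_sq: "Q i * Q i = 1 + lam * Q i"
    and Q_even: "p i = p j \<Longrightarrow> Q i = Q j"
    and Q_odd: "p i \<noteq> p j \<Longrightarrow> Q i * Q j = - 1"
begin

text \<open>If \<open>S\<close> is closed upwards in the lexicographic order, the two generators in
  the tail of the last relation lie in \<open>S\<close> whenever the first factor does.\<close>

definition qmat_rels :: "('n \<times> 'n) set \<Rightarrow> ('n \<times> 'n \<Rightarrow> 'a) \<Rightarrow> bool"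
  where "qmat_rels S y \<longleftrightarrow>
    (\<forall>i j. (i, j) \<in> S \<longrightarrow> p i \<noteq> p j \<longrightarrow> y (i, j) * y (i, j) = 0)
    \<and> (\<forall>i j k. (i, j) \<in> S \<longrightarrow> (i, k) \<in> S \<longrightarrow> j < k \<longrightarrow>
        y (i, j) * y (i, k) = Q i \<star> (y (i, k) * y (i, j)))
    \<and> (\<forall>i j h. (i, j) \<in> S \<longrightarrow> (h, j) \<in> S \<longrightarrow> i < h \<longrightarrow>
        y (i, j) * y (h, j) = Q j \<star> (y (h, j) * y (i, j)))
    \<and> (\<forall>i j h k. (i, j) \<in> S \<longrightarrow> (h, k) \<in> S \<longrightarrow> i < h \<longrightarrow> k < j \<longrightarrow>
        y (i, j) * y (h, k) = y (h, k) * y (i, j))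
    \<and> (\<forall>i j h k. (i, j) \<in> S \<longrightarrow> (h, k) \<in> S \<longrightarrow> i < h \<longrightarrow> j < k \<longrightarrow>
        y (i, j) * y (h, k) = y (h, k) * y (i, j) + lam \<star> (y (i, k) * y (h, j)))"

lemma sc_zero [simp]: "c \<star> 0 = 0" "0 \<star> x = 0"
  using sc_add_right[of c 0 0] sc_add_left[of 0 0 x] by simp_all

lemma sc_minus: "c \<star> (- x) = - (c \<star> x)" "(- c) \<star> x = - (c \<star> x)"
  using sc_add_right[of c x "- x"] sc_add_left[of c "- c" x]
  by (simp_all add: eq_neg_iff_add_eq_0 add.commute)

lemma assoc_ext: "x * y = z \<Longrightarrow> x * (y * w) = z * w" for x :: 'a
  by (simp flip: mult.assoc)

lemmas sc_simps = sc_add_right sc_add_left sc_sc sc_mult_left sc_mult_right mult.assoc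
  distrib_left distrib_right

end

text \<open>\<open>A\<close> becomes the new generator at (i, j), \<open>R\<close> and
  \<open>C\<close> correct the old generators in its row and column, and \<open>D\<close> those
  strictly below and to the right. \<open>AD\<close> is exactly what the last relation for (i, j)
  and (h, k) requires: its tail is the product of the corrected row and column generators.\<close>

locale add_generator = hecke_algebra sc Q lam p
  for sc :: "'k::comm_ring_1 \<Rightarrow> 'a::ring_1 \<Rightarrow> 'a" (infixr "\<star>" 75)
    and Q :: "'n::linorder \<Rightarrow> 'k" and lam :: 'k and p :: "'n \<Rightarrow> bit" +
  fixes i j :: 'n and y :: "'n \<times> 'n \<Rightarrow> 'a" and A R C D :: 'a
  assumes rels: "qmat_rels {(i, j)<..} y"
    and comm: "(i, j) < g \<Longrightarrow> z \<in> {A, R, C, D} \<Longrightarrow> y g * z = z * y g"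
    and AR: "A * R = Q i \<star> (R * A)" and AC: "A * C = Q j \<star> (C * A)"
    and RD: "R * D = Q i \<star> (D * R)" and CD: "C * D = Q j \<star> (D * C)"
    and CR: "C * R = R * C" and AD: "A * D = D * A + lam \<star> (R * C)"
    and AA: "p i \<noteq> p j \<Longrightarrow> A * A = 0" and DD: "p i \<noteq> p j \<Longrightarrow> D * D = 0"
begin

definition x :: "'n \<times> 'n \<Rightarrow> 'a"
  where "x = (\<lambda>(h, k). if h = i \<and> k = j then A else if h = i then R * y (i, k)
    else if k = j then C * y (h, j) else if j < k then y (h, k) + D * (y (i, k) * y (h, j))
    else y (h, k))"

text \<open>The letters name positions relative to (i, j), and the names of the lemmas below use
  them: \<open>A\<close> the place itself, \<open>R\<close> to the right in the row,
  \<open>C\<close> below in the column, \<open>L\<close> lower left, \<open>D\<close> lower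
  right.\<close>

lemma x_A: "x (i, j) = A"
  and x_R: "j < k \<Longrightarrow> x (i, k) = R * y (i, k)"
  and x_C: "i < h \<Longrightarrow> x (h, j) = C * y (h, j)"
  and x_L: "i < h \<Longrightarrow> k < j \<Longrightarrow> x (h, k) = y (h, k)"
  and x_D: "i < h \<Longrightarrow> j < k \<Longrightarrow> x (h, k) = y (h, k) + D * (y (i, k) * y (h, j))"
  by (auto simp: x_def)

lemma mem: "(h, k) \<in> {(i, j)<..} \<longleftrightarrow> i < h \<or> h = i \<and> j < k"
  by (auto simp: less_prod_def)

lemma mem_row: "(h, k) \<in> {(i, j)<..} \<Longrightarrow> k < k' \<Longrightarrow> (h, k') \<in> {(i, j)<..}"
  and mem_col: "(h, k) \<in> {(i, j)<..} \<Longrightarrow> h < h' \<Longrightarrow> (h', k') \<in> {(i, j)<..}"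
  by (auto simp: mem)

text \<open>Membership is required of one generator only: the other one comes later in the
  lexicographic order, so it lies in the same up-set.\<close>

lemma y_square: "i < h \<or> h = i \<and> j < k \<Longrightarrow> p h \<noteq> p k \<Longrightarrow> y (h, k) * y (h, k) = 0"
  and y_row: "i < h \<or> h = i \<and> j < k \<Longrightarrow> k < k' \<Longrightarrow> y (h, k) * y (h, k') = Q h \<star> (y (h, k') * y (h, k))"
  and y_col: "i < h \<or> h = i \<and> j < k \<Longrightarrow> h < h' \<Longrightarrow> y (h, k) * y (h', k) = Q k \<star> (y (h', k) * y (h, k))"
  and y_anti: "i < h \<or> h = i \<and> j < k \<Longrightarrow> h < h' \<Longrightarrow> k' < k \<Longrightarrow> y (h, k) * y (h', k') = y (h', k') * y (h, k)"
  and y_diag: "i < h \<or> h = i \<and> j < k \<Longrightarrow> h < h' \<Longrightarrow> k < k' \<Longrightarrow>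
      y (h, k) * y (h', k') = y (h', k') * y (h, k) + lam \<star> (y (h, k') * y (h', k))"
  using rels mem_row mem_col unfolding qmat_rels_def mem[symmetric] by meson+

lemma y_comm: "i < h \<or> h = i \<and> j < k \<Longrightarrow> z \<in> {A, R, C, D} \<Longrightarrow> y (h, k) * z = z * y (h, k)"
  using comm[of "(h, k)"] by (auto simp: less_prod_def)

lemma y_square': "i < h \<or> h = i \<and> j < k \<Longrightarrow> p h \<noteq> p k \<Longrightarrow> y (h, k) * (y (h, k) * w) = 0"
  by (simp add: y_square assoc_ext)

lemma DD': "p i \<noteq> p j \<Longrightarrow> D * (D * w) = 0"
  by (simp add: DD assoc_ext)

lemma Q_sq': "Q h * (Q h * c) = c + lam * (Q h * c)"
  by (simp add: Q_sq distrib_right flip: mult.assoc)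

text \<open>
  Oriented as rewrite rules, the relations between the operators move scalars and \<^term>\<open>D\<close> to
  the left and sort the old generators in decreasing lexicographic order.
\<close>

lemmas y_rules = y_row y_col y_anti y_diag y_comm
lemmas z_rules = AR AC RD CD CR AD
lemmas x_rules = x_A x_R x_C x_L x_D y_rules y_rules[THEN assoc_ext] z_rules z_rules[THEN assoc_ext]
  y_square y_square' AA DD DD' sc_simps sc_one sc_minus Q_sq Q_sq'
  mult.left_commute[of _ "_::'k"] mult.commute[of _ "_::'k"]

text \<open>In these positions the rewriting to normal form closes the goal without regard to
  parities.\<close>

lemma x_row_AR: "j < k \<Longrightarrow> x (i, j) * x (i, k) = Q i \<star> (x (i, k) * x (i, j))"
  and x_row_RR: "j < k \<Longrightarrow> j < k' \<Longrightarrow> k < k' \<Longrightarrow> x (i, k) * x (i, k') = Q i \<star> (x (i, k') * x (i, k))"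
  and x_row_LC: "i < h \<Longrightarrow> k < j \<Longrightarrow> x (h, k) * x (h, j) = Q h \<star> (x (h, j) * x (h, k))"
  and x_row_LD: "i < h \<Longrightarrow> k < j \<Longrightarrow> j < k' \<Longrightarrow> k < k' \<Longrightarrow> x (h, k) * x (h, k') = Q h \<star> (x (h, k') * x (h, k))"
  and x_row_LL: "i < h \<Longrightarrow> k' < j \<Longrightarrow> k < k' \<Longrightarrow> x (h, k) * x (h, k') = Q h \<star> (x (h, k') * x (h, k))"
  by (simp_all add: x_rules)

text \<open>The sides differ by a multiple of (Q_j - Q_h) y_hj^2: either h and j have equal parity
  and the scalar vanishes, or y_hj is odd and its square vanishes.\<close>

lemma x_row_CD: "i < h \<Longrightarrow> j < k \<Longrightarrow> x (h, j) * x (h, k) = Q h \<star> (x (h, k) * x (h, j))"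
  using Q_even[of h j] by (cases "p h = p j") (simp_all add: x_rules)

text \<open>The terms linear in \<open>D\<close> cancel by Q_h^2 = 1 + lam Q_h. The quadratic ones
  leave a multiple of (Q_i - Q_h) D^2 y_hj^2, which can survive only if i, j and h have equal
  parity, and then the scalar is 0.\<close>

lemma x_row_DD: "i < h \<Longrightarrow> j < k \<Longrightarrow> j < k' \<Longrightarrow> k < k' \<Longrightarrow> x (h, k) * x (h, k') = Q h \<star> (x (h, k') * x (h, k))"
  using Q_even[of i h] by (cases "p i = p j"; cases "p h = p j") (simp_all add: x_rules)

lemma x_col_AC: "i < h \<Longrightarrow> x (i, j) * x (h, j) = Q j \<star> (x (h, j) * x (i, j))"
  and x_col_CC: "i < h \<Longrightarrow> i < h' \<Longrightarrow> h < h' \<Longrightarrow> x (h, j) * x (h', j) = Q j \<star> (x (h', j) * x (h, j))"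
  and x_col_LL: "i < h \<Longrightarrow> i < h' \<Longrightarrow> h < h' \<Longrightarrow> k < j \<Longrightarrow> x (h, k) * x (h', k) = Q k \<star> (x (h', k) * x (h, k))"
  by (simp_all add: x_rules)

text \<open>The term with \<open>D\<close> leaves a multiple of (Q_i - Q_k) y_ik^2, the transpose of
  the situation in \<open>x_row_CD\<close>.\<close>

lemma x_col_RD: "i < h \<Longrightarrow> j < k \<Longrightarrow> x (i, k) * x (h, k) = Q k \<star> (x (h, k) * x (i, k))"
  using Q_even[of i k] by (cases "p i = p k") (simp_all add: x_rules)

text \<open>As in \<open>x_row_DD\<close>, with (Q_j - Q_k) D^2 y_ik^2 as the remainder.\<close>

lemma x_col_DD: "i < h \<Longrightarrow> i < h' \<Longrightarrow> h < h' \<Longrightarrow> j < k \<Longrightarrow> x (h, k) * x (h', k) = Q k \<star> (x (h', k) * x (h, k))"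
  using Q_even[of j k] by (cases "p i = p j"; cases "p i = p k") (simp_all add: x_rules)

lemma x_anti_AL: "i < h \<Longrightarrow> k < j \<Longrightarrow> x (i, j) * x (h, k) = x (h, k) * x (i, j)"
  and x_anti_RL: "i < h \<Longrightarrow> j < k' \<Longrightarrow> k < j \<Longrightarrow> x (i, k') * x (h, k) = x (h, k) * x (i, k')"
  and x_anti_RC: "i < h \<Longrightarrow> j < k \<Longrightarrow> x (i, k) * x (h, j) = x (h, j) * x (i, k)"
  and x_anti_RD: "i < h \<Longrightarrow> j < k \<Longrightarrow> j < k' \<Longrightarrow> k < k' \<Longrightarrow> x (i, k') * x (h, k) = x (h, k) * x (i, k')"
  by (simp_all add: x_rules)

lemma x_anti_CL: "i < h \<Longrightarrow> i < h' \<Longrightarrow> h < h' \<Longrightarrow> k < j \<Longrightarrow> x (h, j) * x (h', k) = x (h', k) * x (h, j)"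
  by (simp_all add: x_rules y_anti[where h = h and k = j and h' = h' and k' = k])

lemma x_anti_LL: "i < h \<Longrightarrow> i < h' \<Longrightarrow> h < h' \<Longrightarrow> k' < j \<Longrightarrow> k < k' \<Longrightarrow> x (h, k') * x (h', k) = x (h', k) * x (h, k')"
  and x_anti_DL: "i < h \<Longrightarrow> i < h' \<Longrightarrow> h < h' \<Longrightarrow> j < k' \<Longrightarrow> k < j \<Longrightarrow> k < k' \<Longrightarrow> x (h, k') * x (h', k) = x (h', k) * x (h, k')"
  by (simp_all add: x_rules y_anti[where h = h and k = k' and h' = h' and k' = k])

lemma x_anti_DC: "i < h \<Longrightarrow> i < h' \<Longrightarrow> h < h' \<Longrightarrow> j < k \<Longrightarrow> x (h, k) * x (h', j) = x (h', j) * x (h, k)"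
  by (simp_all add: x_rules y_anti[where h = h and k = k and h' = h' and k' = j])

text \<open>In the terms linear in \<open>D\<close> the two tails produced by \<open>y_diag\<close>
  cancel; the quadratic ones leave a multiple of (Q_i - Q_j) D^2, where \<open>D\<close> squares to
  0 if i and j have different parity.\<close>

lemma x_anti_DD: "i < h \<Longrightarrow> i < h' \<Longrightarrow> h < h' \<Longrightarrow> j < k \<Longrightarrow> j < k' \<Longrightarrow> k < k' \<Longrightarrow> x (h, k') * x (h', k) = x (h', k) * x (h, k')"
  using Q_even[of i j] by (cases "p i = p j") (simp_all add: x_rules y_anti[where h = h and k = k' and h' = h' and k' = k])

text \<open>In \<open>x_diag_AD\<close> the commutator of \<open>A\<close> and \<open>D\<close>
  yields the tail. In \<open>x_diag_RD\<close> and \<open>x_diag_CD\<close> the terms with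
  \<open>D\<close> balance by the Hecke quadratic for Q_i and Q_j respectively.\<close>

lemma x_diag_AD: "i < h \<Longrightarrow> j < k \<Longrightarrow> x (i, j) * x (h, k) = x (h, k) * x (i, j) + lam \<star> (x (i, k) * x (h, j))"
  and x_diag_RD: "i < h \<Longrightarrow> j < k \<Longrightarrow> j < k' \<Longrightarrow> k < k' \<Longrightarrow> x (i, k) * x (h, k') = x (h, k') * x (i, k) + lam \<star> (x (i, k') * x (h, k))"
  and x_diag_CD: "i < h \<Longrightarrow> i < h' \<Longrightarrow> h < h' \<Longrightarrow> j < k \<Longrightarrow> x (h, j) * x (h', k) = x (h', k) * x (h, j) + lam \<star> (x (h, k) * x (h', j))"
  and x_diag_LL: "i < h \<Longrightarrow> i < h' \<Longrightarrow> h < h' \<Longrightarrow> k' < j \<Longrightarrow> k < k' \<Longrightarrow> x (h, k) * x (h', k') = x (h', k') * x (h, k) + lam \<star> (x (h, k') * x (h', k))"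
  and x_diag_LC: "i < h \<Longrightarrow> i < h' \<Longrightarrow> h < h' \<Longrightarrow> k < j \<Longrightarrow> x (h, k) * x (h', j) = x (h', j) * x (h, k) + lam \<star> (x (h, j) * x (h', k))"
  and x_diag_LD: "i < h \<Longrightarrow> i < h' \<Longrightarrow> h < h' \<Longrightarrow> k < j \<Longrightarrow> j < k' \<Longrightarrow> k < k' \<Longrightarrow> x (h, k) * x (h', k') = x (h', k') * x (h, k) + lam \<star> (x (h, k') * x (h', k))"
  by (simp_all add: x_rules)

text \<open>The part quadratic in \<open>D\<close> has the scalar Q_i Q_j - 1 - lam Q_j = (Q_i -
  Q_j) Q_j, and it meets D^2.\<close>

lemma x_diag_DD: "i < h \<Longrightarrow> i < h' \<Longrightarrow> h < h' \<Longrightarrow> j < k \<Longrightarrow> j < k' \<Longrightarrow> k < k' \<Longrightarrow> x (h, k) * x (h', k') = x (h', k') * x (h, k) + lam \<star> (x (h, k') * x (h', k))"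
  using Q_even[of i j] by (cases "p i = p j") (simp_all add: x_rules)

lemma x_square_A: "p i \<noteq> p j \<Longrightarrow> x (i, j) * x (i, j) = 0"
  and x_square_R: "j < k \<Longrightarrow> p i \<noteq> p k \<Longrightarrow> x (i, k) * x (i, k) = 0"
  and x_square_C: "i < h \<Longrightarrow> p h \<noteq> p j \<Longrightarrow> x (h, j) * x (h, j) = 0"
  and x_square_L: "i < h \<Longrightarrow> k < j \<Longrightarrow> p h \<noteq> p k \<Longrightarrow> x (h, k) * x (h, k) = 0"
  by (simp_all add: x_rules)

text \<open>The two mixed products cancel because moving the old factors past each other costs Q_h
  Q_k = -1. In the square of the correction, different parities of h and k force one of the pairs
  (i, j), (i, k), (h, j) to be odd, so one of the three squares in it is zero.\<close>

lemma x_square_D: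
  assumes "i < h" "j < k" "p h \<noteq> p k"
  shows "x (h, k) * x (h, k) = 0"
proof -
  have "D * (D * (y (h, j) * (y (h, j) * (y (i, k) * y (i, k))))) = 0"
    using assms by (cases "p i = p j"; cases "p i = p k") (simp_all add: y_square y_square' DD')
  moreover have "Q h * Q k = - 1"
    using assms by (simp add: Q_odd)
  moreover have "y (h, k) * y (h, k) = 0"
    using assms by (simp add: y_square)
  ultimately show ?thesis
    using assms(1,2) by (simp add: x_rules)
qed

lemma x_rels: "qmat_rels {(i, j)..} x"
proof -
  \<comment> \<open>Splitting into the five positions makes every instance of a relation one of the
    lemmas above or contradictory.\<close>
  have m: "(h, k) \<in> {(i, j)..} \<longleftrightarrow> (h = i \<and> k = j) \<or> (h = i \<and> j < k) \<or> (i < h \<and> k = j) \<or> (i < h \<and> k < j) \<or> (i < h \<and> j < k)" for h k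
    by (auto simp: less_eq_prod_def)
  show ?thesis unfolding qmat_rels_def m
    apply (intro conjI allI impI)
    subgoal by (elim disjE conjE; simp add: x_square_A x_square_R x_square_C x_square_L x_square_D)
    subgoal
      by (elim disjE conjE) (auto intro: x_row_AR x_row_RR x_row_LC x_row_LD x_row_LL x_row_CD x_row_DD)
    subgoal
      by (elim disjE conjE) (auto intro: x_col_AC x_col_CC x_col_LL x_col_RD x_col_DD)
    subgoal
      by (elim disjE conjE) (auto intro: x_anti_AL x_anti_RL x_anti_RC x_anti_RD x_anti_CL x_anti_LL x_anti_DL x_anti_DC x_anti_DD)
    subgoal
      by (elim disjE conjE) (auto intro: x_diag_AD x_diag_RD x_diag_CD x_diag_LL x_diag_LC x_diag_LD x_diag_DD)
    done
qed

end

section \<open>Evaluation homomorphisms of the free algebra\<close>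

lemma poly_mapping_sum_single: "f = (\<Sum>w\<in>Poly_Mapping.keys f. Poly_Mapping.single w (Poly_Mapping.lookup f w))"
  by (rule poly_mapping_eqI) (auto simp: lookup_sum lookup_single in_keys_iff when_def sum.delta)

definition eval_word :: "('g \<Rightarrow> 'a::monoid_mult) \<Rightarrow> 'g wd \<Rightarrow> 'a"
  where "eval_word x w = prod_list (map x (letters w))"

lemma eval_word_add: "eval_word x (v + w) = eval_word x v * eval_word x w"
  by (simp add: eval_word_def plus_wd_def)

context hecke_algebra
begin

text \<open>The homomorphism provided by the universal property of the free algebra.\<close>

definition eval :: "('g \<Rightarrow> 'a) \<Rightarrow> ('g, 'k) free_alg \<Rightarrow> 'a"
  where "eval x f = (\<Sum>w\<in>Poly_Mapping.keys f. Poly_Mapping.lookup f w \<star> eval_word x w)"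

lemma eval_add: "eval x (f + g) = eval x f + eval x g"
  unfolding eval_def by (rule setsum_keys_plus_distrib) (simp_all add: sc_add_left)

lemma eval_zero: "eval x 0 = 0"
  by (simp add: eval_def)

lemma eval_minus: "eval x (- f) = - eval x f"
  using eval_add[of x f "- f"] by (simp add: eval_zero eq_neg_iff_add_eq_0 add.commute)

lemma eval_diff: "eval x (f - g) = eval x f - eval x g"
  using eval_add[of x f "- g"] by (simp add: eval_minus)

lemma eval_sum: "eval x (sum F S) = (\<Sum>s\<in>S. eval x (F s))"
  by (induction S rule: infinite_finite_induct) (simp_all add: eval_zero eval_add)

lemma eval_single: "eval x (Poly_Mapping.single w c) = c \<star> eval_word x w"
  by (cases "c = 0") (simp_all add: eval_def)

lemma eval_mult: "eval x (f * g) = eval x f * eval x g"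
proof -
  \<comment> \<open>By linearity the left factor may be taken to be a multiple of a single
    word.\<close>
  have "eval x (Poly_Mapping.single v c * g) = (c \<star> eval_word x v) * eval x g" for v c
  proof -
    have "eval x (Poly_Mapping.single v c * g)
      = eval x (\<Sum>w\<in>Poly_Mapping.keys g. Poly_Mapping.single (v + w) (c * Poly_Mapping.lookup g w))"
      by (subst poly_mapping_sum_single[of g]) (simp add: sum_distrib_left mult_single)
    then show ?thesis
      unfolding eval_sum eval_single
      by (simp add: eval_def sum_distrib_left eval_word_add sc_mult_left sc_mult_right sc_sc mult.commute[of c])
  qed
  then have "eval x ((\<Sum>v\<in>Poly_Mapping.keys f. Poly_Mapping.single v (Poly_Mapping.lookup f v)) * g) = eval x f * eval x g"
    by (simp add: sum_distrib_right eval_sum) (simp add: eval_def sum_distrib_right)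
  then show ?thesis by (simp flip: poly_mapping_sum_single)
qed

lemma eval_gen: "eval x (fa_gen g) = x g"
  by (simp add: fa_gen_def eval_single eval_word_def sc_one)

lemma eval_const: "eval x (fa_const c) = c \<star> 1"
  by (simp add: fa_const_def eval_single eval_word_def zero_wd_def)

lemma eval_const_mult: "eval x (fa_const c * f) = c \<star> eval x f"
  by (simp add: eval_mult eval_const sc_mult_left)

end

section \<open>Operators on functions of exponents\<close>

text \<open>Linear endomorphisms form a type of their own so that they are an instance of
  \<open>ring_1\<close> and \<open>hecke_algebra\<close> applies to them. The single identity for a
  u + v covers additivity and homogeneity.\<close>

typedef (overloaded) ('b, 'k::comm_ring_1) endo =
  "{f :: ('b \<Rightarrow> 'k) \<Rightarrow> ('b \<Rightarrow> 'k). \<forall>a u v. f (\<lambda>x. a * u x + v x) = (\<lambda>x. a * f u x + f v x)}"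
  morphisms endo_app Abs_endo
  by (rule exI[of _ "\<lambda>u. u"]) simp

setup_lifting type_definition_endo

lemma endo_app_lin: "endo_app T (\<lambda>x. a * u x + v x) = (\<lambda>x. a * endo_app T u x + endo_app T v x)"
  by transfer simp

lemma endo_app_0: "endo_app T (\<lambda>x. 0) = (\<lambda>x. 0)"
  using endo_app_lin[of T "- 1" "\<lambda>x. 0" "\<lambda>x. 0"] by simp

lemma endo_app_mult: "endo_app T (\<lambda>x. a * u x) = (\<lambda>x. a * endo_app T u x)"
  using endo_app_lin[of T a u "\<lambda>x. 0"] by (simp add: endo_app_0)

instantiation endo :: (type, comm_ring_1) ring_1
begin

lift_definition zero_endo :: "('a, 'b) endo" is "\<lambda>u x. 0" by simp
lift_definition one_endo :: "('a, 'b) endo" is "\<lambda>u. u" by simp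
lift_definition plus_endo :: "('a, 'b) endo \<Rightarrow> ('a, 'b) endo \<Rightarrow> ('a, 'b) endo"
  is "\<lambda>f g u x. f u x + g u x" by (auto simp: algebra_simps)
lift_definition minus_endo :: "('a, 'b) endo \<Rightarrow> ('a, 'b) endo \<Rightarrow> ('a, 'b) endo"
  is "\<lambda>f g u x. f u x - g u x" by (auto simp: algebra_simps)
lift_definition uminus_endo :: "('a, 'b) endo \<Rightarrow> ('a, 'b) endo"
  is "\<lambda>f u x. - f u x" by (auto simp: algebra_simps)
lift_definition times_endo :: "('a, 'b) endo \<Rightarrow> ('a, 'b) endo \<Rightarrow> ('a, 'b) endo"
  is "\<lambda>f g u. f (g u)" by simp

instance
proof
  fix a b c :: "('a, 'b) endo"
  show "a * (b + c) = a * b + a * c"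
  proof (transfer, rule ext)
    fix f g h :: "('a \<Rightarrow> 'b) \<Rightarrow> 'a \<Rightarrow> 'b" and u
    assume "\<forall>a u v. f (\<lambda>x. a * u x + v x) = (\<lambda>x. a * f u x + f v x)"
    from this[rule_format, of 1 "g u" "h u"]
    show "f (\<lambda>x. g u x + h u x) = (\<lambda>x. f (g u) x + f (h u) x)" by simp
  qed
  show "(0::('a, 'b) endo) \<noteq> 1"
    by transfer (simp add: fun_eq_iff, rule exI[of _ "\<lambda>_. 1"], simp)
qed (transfer; simp add: algebra_simps; fail)+

end

lift_definition endo_scale :: "'k::comm_ring_1 \<Rightarrow> ('b, 'k) endo \<Rightarrow> ('b, 'k) endo" (infixr "\<star>" 75)
  is "\<lambda>c f u x. c * f u x" by (auto simp: algebra_simps)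

lift_definition wsub :: "('b \<Rightarrow> 'k) \<Rightarrow> ('b \<Rightarrow> 'b) \<Rightarrow> ('b, 'k::comm_ring_1) endo"
  is "\<lambda>c s u x. c x * u (s x)" by (auto simp: algebra_simps)

lemma endo_app_simps:
  "endo_app 0 f e = 0" "endo_app 1 f = f"
  "endo_app (T + U) f e = endo_app T f e + endo_app U f e"
  "endo_app (T * U) f = endo_app T (endo_app U f)"
  "endo_app (c \<star> T) f e = c * endo_app T f e"
  "endo_app (wsub d s) f e = d e * f (s e)"
  by (transfer; simp)+

lemma endo_eqI: "(\<And>f e. endo_app T f e = endo_app U f e) \<Longrightarrow> T = U"
  by (simp add: endo_app_inject[symmetric] ext)

lemma wsub_mult: "wsub c s * wsub c' s' = wsub (\<lambda>e. c e * c' (s e)) (\<lambda>e. s' (s e))"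
  by (rule endo_eqI) (simp add: endo_app_simps mult.assoc)

text \<open>Operators that touch the exponent of one generator only. They act on functions by
  pulling back, so the map m - 1 raises the exponent of an indicator function and \<open>Suc\<close>
  lowers it.\<close>

definition loc :: "'g \<Rightarrow> (nat \<Rightarrow> 'k) \<Rightarrow> (nat \<Rightarrow> nat) \<Rightarrow> ('g \<Rightarrow> nat, 'k::comm_ring_1) endo"
  where "loc g c s = wsub (\<lambda>e. c (e g)) (\<lambda>e. e(g := s (e g)))"

lemma loc_app: "endo_app (loc g c s) f e = c (e g) * f (e(g := s (e g)))"
  by (simp add: loc_def endo_app_simps)

lemma loc_mult: "loc g c s * loc g c' s' = loc g (\<lambda>m. c m * c' (s m)) (\<lambda>m. s' (s m))"
  by (simp add: loc_def wsub_mult)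

lemma loc_commute: "g \<noteq> g' \<Longrightarrow> loc g c s * loc g' c' s' = loc g' c' s' * loc g c s"
  by (simp add: loc_def wsub_mult fun_upd_twist mult.commute)

lemma loc_scale: "a \<star> loc g c s = loc g (\<lambda>m. a * c m) s"
  by (rule endo_eqI) (simp add: endo_app_simps loc_app mult.assoc)

lemma loc_add: "loc g c s + loc g c' s = loc g (\<lambda>m. c m + c' m) s"
  by (rule endo_eqI) (simp add: endo_app_simps loc_app distrib_right)

text \<open>The substitution matters only where the coefficient is nonzero; this disposes of 0 - 1 =
  0 and of exponents beyond the truncation.\<close>

lemma loc_cong:
  assumes "\<And>m. c m = c' m" "\<And>m. c m \<noteq> 0 \<Longrightarrow> s m = s' m"
  shows "loc g c s = loc g c' s'"
proof (rule endo_eqI)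
  show "endo_app (loc g c s) f e = endo_app (loc g c' s') f e" for f e
    using assms[of "e g"] by (cases "c (e g) = 0") (auto simp: loc_app)
qed

lemma loc_zero: "loc g (\<lambda>m. 0) s = 0"
  by (rule endo_eqI) (simp add: endo_app_simps loc_app)

section \<open>The raising, diagonal and lowering operators of one generator\<close>

locale qmat_rep =
  fixes Q Qi :: "'n::{finite, linorder} \<Rightarrow> 'k::idom" and lam :: 'k and p :: "'n \<Rightarrow> bit"
  assumes Q_sq: "Q i * Q i = 1 + lam * Q i"
    and Q_even: "p i = p j \<Longrightarrow> Q i = Q j"
    and Q_odd: "p i \<noteq> p j \<Longrightarrow> Q i * Q j = - 1"
    and Q_inv: "Q i * Qi i = 1"
begin

sublocale hecke_algebra "endo_scale :: 'k \<Rightarrow> ('n \<times> 'n \<Rightarrow> nat, 'k) endo \<Rightarrow> _" Q lam p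
proof
  fix a c d :: 'k and x y :: "('n \<times> 'n \<Rightarrow> nat, 'k) endo"
  show "a \<star> (x + y) = a \<star> x + a \<star> y" "(c + d) \<star> x = c \<star> x + d \<star> x"
    by (rule endo_eqI; simp add: endo_app_simps algebra_simps)+
  show "c \<star> d \<star> x = (c * d) \<star> x" "1 \<star> x = x" "(c \<star> x) * y = c \<star> (x * y)"
    by (rule endo_eqI; simp add: endo_app_simps mult.assoc)+
  have "endo_app (c \<star> y) f = (\<lambda>e. c * endo_app y f e)" for f
    by (rule ext) (simp add: endo_app_simps)
  then show "x * (c \<star> y) = c \<star> (x * y)"
    by (intro endo_eqI) (simp add: endo_app_simps endo_app_mult)
qed (rule Q_sq, erule Q_even, erule Q_odd)

text \<open>
  An odd generator only has the exponents $0$ and $1$. The operators below vanish on larger ones,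
  so that the relations between them hold on all functions of exponents. The coefficients
  \<open>dco\<close> are the solution $d_m$ of $d_0 = 0$ and
  $d_m - d_{m+1} = \<lambda> (Q_i Q_j)^{-m}$ that \<open>A_D\<close> requires.
\<close>

definition ok :: "'n \<times> 'n \<Rightarrow> nat \<Rightarrow> bool"
  where "ok g m \<longleftrightarrow> (p (fst g) \<noteq> p (snd g) \<longrightarrow> m \<le> 1)"

definition A_op :: "'n \<times> 'n \<Rightarrow> ('n \<times> 'n \<Rightarrow> nat, 'k) endo"
  where "A_op g = loc g (\<lambda>m. if m = 0 \<or> \<not> ok g m then 0 else 1) (\<lambda>m. m - 1)"

definition K_op :: "'n \<times> 'n \<Rightarrow> 'n \<Rightarrow> ('n \<times> 'n \<Rightarrow> nat, 'k) endo"
  where "K_op g i = loc g (\<lambda>m. if ok g m then Qi i ^ m else 0) (\<lambda>m. m)"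

definition dco :: "'n \<times> 'n \<Rightarrow> nat \<Rightarrow> 'k"
  where "dco g m = - lam * (\<Sum>s<m. (Qi (fst g) * Qi (snd g)) ^ s)"

definition D_op :: "'n \<times> 'n \<Rightarrow> ('n \<times> 'n \<Rightarrow> nat, 'k) endo"
  where "D_op g = loc g (\<lambda>m. if ok g (Suc m) then dco g (Suc m) else 0) Suc"

lemma Qi_odd: "p i \<noteq> p j \<Longrightarrow> Qi i * Qi j = - 1"
proof -
  assume "p i \<noteq> p j"
  moreover have "(Q i * Q j) * (Qi i * Qi j) = (Q i * Qi i) * (Q j * Qi j)"
    by (simp only: ac_simps)
  ultimately show ?thesis
    by (simp add: Q_inv Q_odd minus_equation_iff[of _ 1] eq_commute[of "- 1"])
qed

lemma A_K: "A_op g * K_op g i = Q i \<star> (K_op g i * A_op g)"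
proof -
  have "ok g m \<Longrightarrow> ok g (m - 1)" for m by (auto simp: ok_def)
  \<comment> \<open>With \<open>A_op\<close> applied last, the diagonal factor is read at m - 1
    instead of m, hence the extra factor Q_i.\<close>
  moreover have "Q i * Qi i ^ m = Qi i ^ (m - 1)" if "m > 0" for m
    using that Q_inv[of i] by (cases m) (simp_all flip: mult.assoc)
  ultimately show ?thesis
    unfolding A_op_def K_op_def loc_mult loc_scale by (intro loc_cong) auto
qed

lemma K_D: "K_op g i * D_op g = Q i \<star> (D_op g * K_op g i)"
proof -
  have "ok g (Suc m) \<Longrightarrow> ok g m" for m by (auto simp: ok_def)
  moreover have "Q i * (Qi i * z) = z" for z
    using Q_inv[of i] by (simp flip: mult.assoc)
  ultimately show ?thesis
    unfolding D_op_def K_op_def loc_mult loc_scale by (intro loc_cong) auto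
qed

lemma K_K: "K_op g i * K_op g j = K_op g j * K_op g i"
  unfolding K_op_def loc_mult by (intro loc_cong) auto

lemma A_D: "A_op (i, j) * D_op (i, j) = D_op (i, j) * A_op (i, j) + lam \<star> (K_op (i, j) i * K_op (i, j) j)"
proof -
  let ?g = "(i, j)"
  \<comment> \<open>At m = 0 the cutoff in \<open>A_op\<close> agrees with the initial value 0 of
    \<open>dco\<close>.\<close>
  have 1: "A_op ?g * D_op ?g = loc ?g (\<lambda>m. if ok ?g m then dco ?g m else 0) (\<lambda>m. m)"
    unfolding A_op_def D_op_def loc_mult by (rule loc_cong; case_tac m; simp add: dco_def)
  have "dco ?g m = (if ok ?g (Suc m) then dco ?g (Suc m) else 0) + lam * (Qi i ^ m * Qi j ^ m)" if "ok ?g m" for m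
  proof (cases "ok ?g (Suc m)")
    case True
    then show ?thesis by (simp add: dco_def algebra_simps power_mult_distrib)
  next
    \<comment> \<open>At the boundary m = 1 of an odd generator the product with \<open>D_op\<close>
      on the left is cut off. The identity survives because d_1 = - lam and the inverses of Q_i and
      Q_j multiply to -1.\<close>
    case False
    then have "m = 1" "p i \<noteq> p j" using that by (auto simp: ok_def)
    then show ?thesis using False by (simp add: dco_def Qi_odd)
  qed
  moreover have "ok ?g (Suc m) \<Longrightarrow> ok ?g m" for m by (auto simp: ok_def)
  ultimately show ?thesis
    unfolding 1 unfolding A_op_def D_op_def K_op_def loc_mult loc_scale
    by (simp add: loc_add, intro loc_cong) auto
qed

text \<open>The two factors together demand an exponent that is at least 2 and within the
  truncation, which is impossible for an odd generator; the same happens in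
  \<open>D_D\<close>.\<close>

lemma A_A: "p i \<noteq> p j \<Longrightarrow> A_op (i, j) * A_op (i, j) = 0"
  unfolding A_op_def loc_mult by (subst loc_zero[symmetric], rule loc_cong) (auto simp: ok_def)

lemma D_D: "p i \<noteq> p j \<Longrightarrow> D_op (i, j) * D_op (i, j) = 0"
  unfolding D_op_def loc_mult by (subst loc_zero[symmetric], rule loc_cong) (auto simp: ok_def)

end

section \<open>Weights of generators and exponents\<close>

definition wt :: "'n::{finite, linorder} \<times> 'n \<Rightarrow> nat"
  where "wt g = card {..<fst g} * card {..<snd g}"

text \<open>The difference of the sides is the product of the distances from i to h and from j to
  k.\<close>

lemma wt_diag:
  assumes "i < h" "j < k"
  shows "wt (i, k) + wt (h, j) < wt (i, j) + wt (h, k)"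
proof -
  have "card {..<i} < card {..<h}" "card {..<j} < card {..<k}"
    using assms by (auto intro!: psubset_card_mono)
  then obtain a b where "card {..<h} = card {..<i} + Suc a" "card {..<k} = card {..<j} + Suc b"
    by (metis less_iff_Suc_add add_Suc_right)
  then show ?thesis by (simp add: wt_def algebra_simps)
qed

definition exp_wt :: "('n::{finite, linorder} \<times> 'n \<Rightarrow> nat) \<Rightarrow> nat"
  where "exp_wt e = (\<Sum>g\<in>UNIV. wt g * e g)"

lemma exp_wt_upd: "exp_wt (e(g := m)) + wt g * e g = exp_wt e + wt g * m"
proof -
  have "(\<Sum>g'\<in>UNIV - {g}. wt g' * (e(g := m)) g') = (\<Sum>g'\<in>UNIV - {g}. wt g' * e g')"
    by (intro sum.cong) auto
  then show ?thesis by (simp add: exp_wt_def sum.remove[of UNIV g])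
qed

lemma exp_wt_Suc: "exp_wt (e(g := Suc (e g))) = exp_wt e + wt g"
  using exp_wt_upd[of e g "Suc (e g)"] by simp

lemma exp_wt_pred: "e g > 0 \<Longrightarrow> exp_wt (e(g := e g - 1)) + wt g = exp_wt e"
  using exp_wt_upd[of e g "e g - 1"] by (cases "e g") simp_all

section \<open>Diagonal operators given by characters of the exponents\<close>

lemma endo_scale_cancel: "a \<noteq> 0 \<Longrightarrow> a \<star> T = a \<star> U \<Longrightarrow> T = U"
  for a :: "'k::idom"
  by (rule endo_eqI) (metis endo_app_simps(5) mult_left_cancel)

lemma dvd_1_mult: "a dvd 1 \<Longrightarrow> b dvd 1 \<Longrightarrow> a * b dvd 1" for a b :: "'k::comm_semiring_1"
  using mult_dvd_mono[of a 1 b 1] by simp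

definition T_op :: "('g::finite \<Rightarrow> 'k) \<Rightarrow> ('g \<Rightarrow> nat, 'k::comm_ring_1) endo"
  where "T_op t = wsub (\<lambda>e. \<Prod>g\<in>UNIV. t g ^ e g) (\<lambda>e. e)"

lemma T_app: "endo_app (T_op t) f e = (\<Prod>g\<in>UNIV. t g ^ e g) * f e"
  by (simp add: T_op_def endo_app_simps)

lemma T_T: "T_op t * T_op t' = T_op (\<lambda>g. t g * t' g)"
  by (rule endo_eqI) (simp add: endo_app_simps T_app power_mult_distrib prod.distrib mult.assoc)

text \<open>The factors of the character at all other generators agree on both sides, so the
  hypothesis concerns the exponent of \<open>g\<close> alone. Scalars on both sides avoid
  division.\<close>

lemma T_loc:
  assumes "\<And>m. c m \<noteq> 0 \<Longrightarrow> a * t g ^ m = b * t g ^ s m"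
  shows "a \<star> (T_op t * loc g c s) = b \<star> (loc g c s * T_op t)"
proof (rule endo_eqI)
  fix f e
  let ?P = "\<Prod>g'\<in>UNIV - {g}. t g' ^ e g'"
  have "(\<Prod>g'\<in>UNIV - {g}. t g' ^ (e(g := s (e g))) g') = ?P"
    by (intro prod.cong) auto
  then have 1: "(\<Prod>g'\<in>UNIV. t g' ^ (e(g := s (e g))) g') = t g ^ s (e g) * ?P"
    by (simp add: prod.remove[of UNIV g])
  have 2: "(\<Prod>g'\<in>UNIV. t g' ^ e g') = t g ^ e g * ?P"
    by (simp add: prod.remove[of UNIV g])
  have "a * (t g ^ e g * ?P * (c (e g) * z)) = b * (c (e g) * (t g ^ s (e g) * ?P * z))" for z
  proof (cases "c (e g) = 0")
    case False
    have "a * (t g ^ e g * ?P * (c (e g) * z)) = (a * t g ^ e g) * (?P * c (e g) * z)"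
      by (simp only: ac_simps)
    also have "\<dots> = b * (c (e g) * (t g ^ s (e g) * ?P * z))"
      unfolding assms[OF False] by (simp only: ac_simps)
    finally show ?thesis .
  qed simp
  then show "endo_app (a \<star> (T_op t * loc g c s)) f e = endo_app (b \<star> (loc g c s * T_op t)) f e"
    by (simp add: endo_app_simps T_app loc_app 1 2 del: fun_upd_apply)
qed

section \<open>Homogeneity, leading terms and the inductive construction\<close>

context qmat_rep
begin

definition truncated :: "('n \<times> 'n \<Rightarrow> nat) \<Rightarrow> bool"
  where "truncated e \<longleftrightarrow> (\<forall>g. ok g (e g))"

text \<open>The relations preserve row and column degrees but not the degree in each generator. The
  product condition says that (i, j), (h, k) and the pair (i, k), (h, j) in the tail have the same
  value.\<close>

definition bimult :: "('n \<times> 'n \<Rightarrow> 'k) \<Rightarrow> bool"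
  where "bimult t \<longleftrightarrow> (\<forall>g. t g \<noteq> 0) \<and> (\<forall>i j h k. t (i, j) * t (h, k) = t (i, k) * t (h, j))"

definition bounded_by :: "nat \<Rightarrow> (('n \<times> 'n \<Rightarrow> nat) \<Rightarrow> 'k) \<Rightarrow> bool"
  where "bounded_by w f \<longleftrightarrow> (\<forall>e. w < exp_wt e \<longrightarrow> f e = 0)"

text \<open>In the highest weight that \<open>T\<close> can reach, it agrees at truncated exponents
  with raising the exponent of \<open>g\<close>, up to the unit \<open>u\<close>.\<close>

definition lead :: "'n \<times> 'n \<Rightarrow> ('n \<times> 'n \<Rightarrow> nat, 'k) endo \<Rightarrow> (('n \<times> 'n \<Rightarrow> nat) \<Rightarrow> 'k) \<Rightarrow> bool"
  where "lead g T u \<longleftrightarrow> (\<forall>e. truncated e \<longrightarrow> u e dvd 1) \<and>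
    (\<forall>w f. bounded_by w f \<longrightarrow> bounded_by (w + wt g) (endo_app T f) \<and>
      (\<forall>e. exp_wt e = w + wt g \<longrightarrow> truncated e \<longrightarrow> endo_app T f e = u e * endo_app (A_op g) f e))"

text \<open>The invariant of the induction. Commuting with operators on exponents outside
  \<open>S\<close> is what lets the next generator be adjoined; homogeneity is for the twist and the
  leading terms are for linear independence.\<close>

definition good :: "('n \<times> 'n) set \<Rightarrow> ('n \<times> 'n \<Rightarrow> ('n \<times> 'n \<Rightarrow> nat, 'k) endo) \<Rightarrow> bool"
  where "good S x \<longleftrightarrow> qmat_rels S x \<and> (\<forall>g\<in>S.
    (\<forall>g' c s. g' \<notin> S \<longrightarrow> x g * loc g' c s = loc g' c s * x g) \<and>
    (\<forall>t. bimult t \<longrightarrow> T_op t * x g = t g \<star> (x g * T_op t)) \<and>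
    (\<exists>u. lead g (x g) u))"

lemma T_A: "T_op t * A_op g = t g \<star> (A_op g * T_op t)"
proof -
  have "t g ^ m = t g * t g ^ (m - 1)" if "m \<noteq> 0" for m
    using that by (simp add: power_eq_if)
  then have "1 \<star> (T_op t * A_op g) = t g \<star> (A_op g * T_op t)"
    unfolding A_op_def by (intro T_loc) (simp split: if_splits)
  then show ?thesis by (simp add: sc_one)
qed

lemma T_K: "T_op t * K_op g i = K_op g i * T_op t"
proof -
  have "1 \<star> (T_op t * K_op g i) = 1 \<star> (K_op g i * T_op t)"
    unfolding K_op_def by (intro T_loc) simp
  then show ?thesis by (simp add: sc_one)
qed

text \<open>Lowering divides by \<open>t g\<close>; the scalar stands on the other side instead of
  its inverse.\<close>

lemma T_D: "t g \<star> (T_op t * D_op g) = D_op g * T_op t"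
proof -
  have "t g \<star> (T_op t * D_op g) = 1 \<star> (D_op g * T_op t)"
    unfolding D_op_def by (intro T_loc) simp
  then show ?thesis by (simp add: sc_one)
qed

lemma lead_A: "lead g (A_op g) (\<lambda>e. 1)"
  unfolding lead_def bounded_by_def
proof (intro conjI allI impI)
  fix w :: nat and f :: "('n \<times> 'n \<Rightarrow> nat) \<Rightarrow> 'k" and e :: "'n \<times> 'n \<Rightarrow> nat"
  assume f: "\<forall>e. w < exp_wt e \<longrightarrow> f e = 0" and e: "w + wt g < exp_wt e"
  then show "endo_app (A_op g) f e = 0"
    using exp_wt_pred[of e g] by (auto simp: A_op_def loc_app)
qed auto

text \<open>A diagonal operator preserves the weight, and its entries at truncated exponents are
  powers of the unit \<open>Qi i\<close>.\<close>

lemma lead_K: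
  assumes "lead g T u" "g \<noteq> g'"
  shows "lead g (K_op g' i * T) (\<lambda>e. (if ok g' (e g') then Qi i ^ e g' else 0) * u e)"
proof -
  have "Qi i ^ m dvd 1" for m
    using Q_inv[of i] by (metis dvd_def dvd_power_same mult.commute power_one)
  then show ?thesis
    using assms unfolding lead_def bounded_by_def truncated_def
    by (auto simp: endo_app_simps K_op_def loc_app mult.assoc intro!: dvd_1_mult
        simp del: split_paired_All split_paired_Ex)
qed

text \<open>\<open>U * V\<close> raises the weight by at most wt (i, k) + wt (h, j) and
  \<open>D_op (i, j)\<close> lowers it by wt (i, j). By \<open>wt_diag\<close> the correction stays
  strictly below the leading weight of (h, k).\<close>

lemma lead_D:
  assumes "lead g T u" "lead (i, k) U u'" "lead (h, j) V u''"
    and g: "g = (h, k)" "i < h" "j < k"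
  shows "lead g (T + D_op (i, j) * (U * V)) u"
proof -
  have "endo_app (D_op (i, j) * (U * V)) f e = 0" if "bounded_by w f" "w + wt g \<le> exp_wt e" for w f e
  proof -
    have "bounded_by (w + wt (h, j) + wt (i, k)) (endo_app U (endo_app V f))"
      using assms that unfolding lead_def by blast
    moreover have "w + wt (h, j) + wt (i, k) < exp_wt (e((i, j) := Suc (e (i, j))))"
      using wt_diag[OF g(2,3)] that(2) by (simp add: exp_wt_Suc g)
    ultimately show ?thesis
      by (simp add: endo_app_simps D_op_def loc_app bounded_by_def)
  qed
  with assms(1) show ?thesis
    unfolding lead_def by (auto simp: endo_app_simps bounded_by_def)
qed

lemma good_step:
  assumes "good {(i, j)<..} y"
  shows "\<exists>x. good {(i, j)..} x"
proof -
  let ?g = "(i, j)"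
  let ?A = "A_op ?g" and ?R = "K_op ?g i" and ?C = "K_op ?g j" and ?D = "D_op ?g"
  have rels: "qmat_rels {?g<..} y"
    and loc: "\<And>g g' c s. ?g < g \<Longrightarrow> g' \<le> ?g \<Longrightarrow> y g * loc g' c s = loc g' c s * y g"
    and hom: "\<And>g t. ?g < g \<Longrightarrow> bimult t \<Longrightarrow> T_op t * y g = t g \<star> (y g * T_op t)"
    and lead: "\<And>g. ?g < g \<Longrightarrow> \<exists>u. lead g (y g) u"
    using assms unfolding good_def by (auto simp: not_less simp del: split_paired_All)
  interpret G: add_generator endo_scale Q lam p i j y ?A ?R ?C ?D
  \<comment> \<open>The old operators commute with \<open>loc\<close> at every generator up to and
    including (i, j), hence with the four new operators.\<close>
  proof
    show "y g * z = z * y g" if "?g < g" "z \<in> {?A, ?R, ?C, ?D}" for g z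
      using that loc[of g ?g] by (auto simp: A_op_def K_op_def D_op_def)
  qed (auto simp: rels A_K K_D K_K A_D A_A D_D)
  have cases: "g = ?g \<and> G.x g = ?A
      \<or> (\<exists>k. j < k \<and> g = (i, k) \<and> ?g < g \<and> G.x g = ?R * y g)
      \<or> (\<exists>h. i < h \<and> g = (h, j) \<and> ?g < g \<and> G.x g = ?C * y g)
      \<or> ?g < g \<and> G.x g = y g
      \<or> (\<exists>h k. i < h \<and> j < k \<and> g = (h, k) \<and> ?g < g \<and> ?g < (i, k) \<and> ?g < (h, j) \<and>
          G.x g = y g + ?D * (y (i, k) * y (h, j)))" if "?g \<le> g" for g
    using that by (cases g) (auto simp: G.x_def less_eq_prod_def less_prod_def)
  have "good {?g..} G.x" unfolding good_def
  proof (intro conjI ballI allI impI)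
    show "qmat_rels {?g..} G.x" by (rule G.x_rels)
  next
    fix g g' and c :: "nat \<Rightarrow> 'k" and s :: "nat \<Rightarrow> nat"
    assume g: "g \<in> {?g..}" and g': "g' \<notin> {?g..}"
    let ?L = "loc g' c s"
    have n: "?g \<noteq> g'" "g' \<le> ?g" using g' by auto
    have l: "y g * ?L = ?L * y g" if "?g < g" for g using that n by (intro loc) auto
    have z: "?A * ?L = ?L * ?A" "K_op ?g b * ?L = ?L * K_op ?g b" "?D * ?L = ?L * ?D" for b
      unfolding A_op_def K_op_def D_op_def by (rule loc_commute[OF n(1)])+
    note r = l z l[THEN assoc_ext] z[THEN assoc_ext]
    from cases[OF g[unfolded atLeast_iff]] show "G.x g * ?L = ?L * G.x g"
      by (elim disjE conjE exE) (auto simp: r mult.assoc distrib_left distrib_right)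
  next
    fix g t
    assume g: "g \<in> {?g..}" and t: "bimult t"
    let ?T = "T_op t"
    have h: "?T * y g = t g \<star> (y g * ?T)" if "?g < g" for g using that t by (rule hom)
    have DUV: "?T * (?D * (y (i, k) * y (h, j))) = t (h, k) \<star> (?D * (y (i, k) * y (h, j)) * ?T)"
      if "?g < (i, k)" "?g < (h, j)" for h k
    \<comment> \<open>Since \<open>T_D\<close> carries the scalar t (i, j) on the side of
      \<open>T_op t\<close>, the identity is proved after multiplying by it; \<open>bimult\<close>
      then supplies t (i, k) t (h, j) = t (i, j) t (h, k).\<close>
    proof (rule endo_scale_cancel)
      show "t ?g \<noteq> 0" using t by (auto simp: bimult_def)
      have "t ?g \<star> (?T * (?D * (y (i, k) * y (h, j)))) = (t ?g \<star> (?T * ?D)) * (y (i, k) * y (h, j))"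
        by (simp add: sc_mult_left mult.assoc)
      also have "\<dots> = (t (i, k) * t (h, j)) \<star> (?D * (y (i, k) * y (h, j)) * ?T)"
        unfolding T_D using h[OF that(1)] h[OF that(2)] h[OF that(1), THEN assoc_ext]
        by (simp add: sc_mult_left sc_mult_right sc_sc mult.assoc)
      also have "t (i, k) * t (h, j) = t ?g * t (h, k)" using t by (simp add: bimult_def)
      finally show "t ?g \<star> (?T * (?D * (y (i, k) * y (h, j)))) = t ?g \<star> t (h, k) \<star> (?D * (y (i, k) * y (h, j)) * ?T)"
        by (simp add: sc_sc)
    qed
    have K: "?T * (K_op ?g b * y g) = t g \<star> (K_op ?g b * y g * ?T)" if "?g < g" for b g
      using h[OF that] T_K[of t ?g b, THEN assoc_ext] by (simp add: sc_mult_right mult.assoc)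
    from cases[OF g[unfolded atLeast_iff]] show "?T * G.x g = t g \<star> (G.x g * ?T)"
      by (elim disjE conjE exE) (auto simp: T_A K h DUV distrib_left distrib_right sc_add_right)
  next
    fix g assume g: "g \<in> {?g..}"
    have A: "\<exists>u. lead ?g ?A u" using lead_A by blast
    have K: "\<exists>u. lead g (K_op ?g b * y g) u" if "?g < g" for g b
      using lead[OF that] lead_K[of g "y g" _ ?g b] that by blast
    have D: "\<exists>u. lead (h, k) (y (h, k) + ?D * (y (i, k) * y (h, j))) u"
      if "i < h" "j < k" "?g < (h, k)" "?g < (i, k)" "?g < (h, j)" for h k
      using lead[OF that(3)] lead[OF that(4)] lead[OF that(5)] lead_D[OF _ _ _ refl that(1,2)] by blast
    from cases[OF g[unfolded atLeast_iff]] show "\<exists>u. lead g (G.x g) u"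
      by (elim disjE conjE exE) (simp_all add: A K D lead del: less_prod_simp)
  qed
  show ?thesis by (rule exI[of _ G.x]) fact
qed

text \<open>A nonempty up-set is the interval above its minimum. Removing the minimum leaves an
  up-set, so the generators are adjoined in decreasing order.\<close>

lemma good_upset: "\<forall>a\<in>S. {a..} \<subseteq> S \<Longrightarrow> \<exists>x. good S x"
proof (induction "card S" arbitrary: S)
  case 0
  then have "S = {}" by simp
  then show ?case by (simp add: good_def qmat_rels_def)
next
  case (Suc n)
  have "S \<noteq> {}" "finite S" using Suc.hyps(2) by auto
  then have m: "Min S \<in> S" "\<And>a. a \<in> S \<Longrightarrow> Min S \<le> a" by simp_all
  obtain i j where ij: "Min S = (i, j)" by (cases "Min S")
  have S: "S = {(i, j)..}" using Suc.prems m unfolding ij by fast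
  have "card {(i, j)<..} = n"
  proof -
    have "S = insert (i, j) {(i, j)<..}" unfolding S by auto
    then show ?thesis using Suc.hyps(2) by simp
  qed
  moreover have "\<forall>a\<in>{(i, j)<..}. {a..} \<subseteq> {(i, j)<..}"
    by (meson atLeast_iff greaterThan_iff less_le_trans subsetI)
  ultimately obtain y where "good {(i, j)<..} y"
    using Suc.hyps(1)[of "{(i, j)<..}"] by blast
  then show ?case unfolding S by (rule good_step)
qed

end

section \<open>The action of the quantum matrix superalgebra\<close>

lemma ring_of_type: "ring (ring_of_type_algebra :: 'a::ring_1 ring)"
proof -
  have "\<exists>y. x + y = 0" for x :: 'a
    using add.right_inverse by blast
  then show ?thesis
    unfolding ring_of_type_algebra_def using add.right_inverse
    by unfold_locales (auto simp: algebra_simps Units_def)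
qed

lemma ring_of_type_simps [simp]:
  "carrier ring_of_type_algebra = UNIV" "x \<otimes>\<^bsub>ring_of_type_algebra\<^esub> y = x * y"
  "x \<oplus>\<^bsub>ring_of_type_algebra\<^esub> y = x + y" "\<one>\<^bsub>ring_of_type_algebra\<^esub> = 1"
  "\<zero>\<^bsub>ring_of_type_algebra\<^esub> = 0"
  by (simp_all add: ring_of_type_algebra_def)

lemma ring_of_type_a_minus: "\<ominus>\<^bsub>ring_of_type_algebra\<^esub> x = - (x :: 'a::ring_1)"
proof -
  interpret ring "ring_of_type_algebra :: 'a ring" by (rule ring_of_type)
  show ?thesis using minus_equality[of "- x" x] by simp
qed

lemma ideal_ring_of_typeI:
  fixes I :: "'a::ring_1 set"
  assumes "0 \<in> I" "\<And>a b. a \<in> I \<Longrightarrow> b \<in> I \<Longrightarrow> a + b \<in> I" "\<And>a x. a \<in> I \<Longrightarrow> x * a \<in> I" "\<And>a x. a \<in> I \<Longrightarrow> a * x \<in> I"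
  shows "ideal I ring_of_type_algebra"
proof -
  interpret ring "ring_of_type_algebra :: 'a ring" by (rule ring_of_type)
  have "subgroup I (add_monoid ring_of_type_algebra)"
  proof (rule subgroup.intro)
    show "inv\<^bsub>add_monoid ring_of_type_algebra\<^esub> a \<in> I" if "a \<in> I" for a
      using assms(3)[OF that, of "- 1"] unfolding a_inv_def[symmetric] ring_of_type_a_minus by simp
  qed (use assms in auto)
  then show ?thesis
    using assms by (intro idealI ring_of_type) auto
qed

section \<open>Units, signs and twisting scalars in the Laurent polynomials\<close>

lemma var_pow_mult: "var_pow v a * var_pow v b = var_pow v (a + b)"
  by (simp add: var_pow_def mult_single single_add)

lemma var_pow_0: "var_pow v 0 = 1"
  by (simp add: var_pow_def)

lemma q1_pow_mult: "q1_pow p s a * q1_pow p s b = q1_pow p s (a + b)"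
  by (simp add: q1_pow_def var_pow_mult distrib_left)

lemma q1_pow_0: "q1_pow p s 0 = 1"
  by (simp add: q1_pow_def var_pow_0)

lemma q2_pow_inv: "q2_pow i j z * q2_pow i j (- z) = 1" "q2_pow i j z * q2_pow j i z = 1"
  by (auto simp: q2_pow_def var_pow_mult var_pow_0)

lemma sgn_bit_square: "sgn_bit a * sgn_bit a = 1"
  by (simp add: sgn_bit_def)

text \<open>\<open>hQ p z i\<close> is $Q_i^z$ for $z = \<plusminus>1$ only: the sign does not depend on \<open>z\<close>.\<close>

definition hQ :: "('n \<Rightarrow> bit) \<Rightarrow> int \<Rightarrow> 'n \<Rightarrow> ('n::linorder, 'k::field_char_0) laurent"
  where "hQ p z i = sgn_bit (p i) * q1_pow p i z"

definition hlam :: "('n::linorder, 'k::field_char_0) laurent"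
  where "hlam = var_pow (Abs_qvar None) 1 - var_pow (Abs_qvar None) (- 1)"

text \<open>For odd i both the sign and the exponent of q are reversed, so the right side is the
  same for all i.\<close>

lemma hlam_eq: "hlam = sgn_bit (p i) * (q1_pow p i 1 - q1_pow p i (- 1))"
  by (simp add: hlam_def q1_pow_def sgn_bit_def)

text \<open>
  If the operators $y_a$ satisfy the untwisted relations and $T_a$ multiplies a vector of degree $b$
  by \<open>twist p a b\<close>, then the operators $y_a T_a$ satisfy the relations of the quantum matrix
  superalgebra.
\<close>

definition twist :: "('n \<Rightarrow> bit) \<Rightarrow> 'n \<times> 'n \<Rightarrow> 'n \<times> 'n \<Rightarrow> ('n::linorder, 'k::field_char_0) laurent"
  where "twist p a b = sgn_bit (p (fst a) * p (snd b))
    * (if fst a < fst b then sgn_bit (p (fst a) * p (fst b)) * q2_pow (fst a) (fst b) 1 else 1)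
    * (if snd a < snd b then sgn_bit (p (snd a) * p (snd b)) * q2_pow (snd a) (snd b) (- 1) else 1)"

lemma sgn_bit_dvd_1: "sgn_bit c dvd (1 :: 'a::comm_ring_1)"
  by (simp add: sgn_bit_def)

lemma pow_dvd_1: "q1_pow p i z dvd 1" "q2_pow i j z dvd 1"
proof -
  have "1 = q1_pow p i z * q1_pow p i (- z)" by (simp add: q1_pow_mult q1_pow_0)
  then show "q1_pow p i z dvd 1" by (rule dvdI)
  show "q2_pow i j z dvd 1" by (rule dvdI[OF q2_pow_inv(1)[symmetric]])
qed

lemma bits: "(a :: bit) = 0 \<or> a = 1" 
  by (cases a) auto

text \<open>One comparison of scalars for each relation: the twist of the left product against the
  prescribed coefficient times the twist of the right product.\<close>

lemma
  fixes p :: "'n::linorder \<Rightarrow> bit"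
  shows twist_row: "j < k \<Longrightarrow> twist p (i, j) (i, k) * hQ p 1 i =
      sgn_bit (par p i j * par p i k) * q1_pow p i 1 * q2_pow j k (- 1) * twist p (i, k) (i, j)"
    and twist_col: "i < h \<Longrightarrow> twist p (i, j) (h, j) * hQ p 1 j =
      sgn_bit (par p i j * par p h j) * q1_pow p j 1 * q2_pow i h 1 * twist p (h, j) (i, j)"
    and twist_anti: "i < h \<Longrightarrow> k < j \<Longrightarrow> (twist p (i, j) (h, k) :: ('n, 'k::field_char_0) laurent) =
      sgn_bit (par p i j * par p h k) * q2_pow i h 1 * q2_pow j k (- 1) * twist p (h, k) (i, j)"
    and twist_diag: "i < h \<Longrightarrow> j < k \<Longrightarrow> (twist p (i, j) (h, k) :: ('n, 'k) laurent) =
      sgn_bit (par p i j * par p h k) * q2_pow i h 1 * q2_pow j k (- 1) * twist p (h, k) (i, j)"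
    and twist_tail: "i < h \<Longrightarrow> j < k \<Longrightarrow> twist p (i, j) (h, k) * (hlam :: ('n, 'k) laurent) =
      sgn_bit (par p i j * par p i k) * (q1_pow p i 1 - q1_pow p i (- 1)) * q2_pow j k (- 1) * twist p (i, k) (h, j)"
proof -
  show "j < k \<Longrightarrow> twist p (i, j) (i, k) * hQ p 1 i =
      sgn_bit (par p i j * par p i k) * q1_pow p i 1 * q2_pow j k (- 1) * twist p (i, k) (i, j)"
    using bits[of "p i"] bits[of "p j"] bits[of "p k"]
    by (elim disjE) (simp_all add: twist_def hQ_def par_def sgn_bit_def)
  show "i < h \<Longrightarrow> twist p (i, j) (h, j) * hQ p 1 j =
      sgn_bit (par p i j * par p h j) * q1_pow p j 1 * q2_pow i h 1 * twist p (h, j) (i, j)"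
    using bits[of "p i"] bits[of "p j"] bits[of "p h"]
    by (elim disjE) (simp_all add: twist_def hQ_def par_def sgn_bit_def)
  \<comment> \<open>The exponent of the sign is expanded bilinearly; in the second identity the
    square of p(i) is p(i).\<close>
  have S: "sgn_bit (par p i j * par p h k) = sgn_bit (p i * p k) * sgn_bit (p i * p h) *
      sgn_bit (p h * p j) * (sgn_bit (p j * p k) :: ('n, 'k) laurent)"
    "sgn_bit (par p i j * par p i k) = sgn_bit (p i) * sgn_bit (p i * p k) *
      sgn_bit (p i * p j) * (sgn_bit (p j * p k) :: ('n, 'k) laurent)"
    using bits[of "p i"] bits[of "p j"] bits[of "p h"] bits[of "p k"]
    by (elim disjE; simp add: par_def sgn_bit_def)+
  note if_simps = if_P if_not_P[OF less_not_sym]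
  \<comment> \<open>The remaining identities are rearrangements of commuting factors in which signs
    square to 1 and q_{j,k} meets its inverse.\<close>
  have 1: "s * (t * q) * 1 = s * t * u * v * q * a * (u * 1 * (v * b))"
    if "a * b = 1" "u * u = 1" "v * v = 1" for s t q u v a b :: "('n, 'k) laurent"
  proof -
    have "s * t * u * v * q * a * (u * 1 * (v * b)) = s * (t * q) * ((u * u) * (v * v) * (a * b))"
      by (simp only: ac_simps mult_1_left)
    then show ?thesis using that by simp
  qed
  have 2: "s * (t * q) * (v * q') = s * t * u * v * q * q' * (u * 1 * 1)"
    if "u * u = 1" for s t q u v q' :: "('n, 'k) laurent"
  proof -
    have "s * t * u * v * q * q' * (u * 1 * 1) = s * (t * q) * (v * q') * (u * u)"
      by (simp only: ac_simps mult_1_left)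
    then show ?thesis using that by simp
  qed
  have 3: "s * (t * q) * (v * q') * (x * d) = x * s * w * v * d * q' * (w * (t * q) * 1)"
    if "w * w = 1" for s t q v q' x d w :: "('n, 'k) laurent"
  proof -
    have "x * s * w * v * d * q' * (w * (t * q) * 1) = s * (t * q) * (v * q') * (x * d) * (w * w)"
      by (simp only: ac_simps mult_1_left)
    then show ?thesis using that by simp
  qed
  show "i < h \<Longrightarrow> k < j \<Longrightarrow> (twist p (i, j) (h, k) :: ('n, 'k) laurent) =
      sgn_bit (par p i j * par p h k) * q2_pow i h 1 * q2_pow j k (- 1) * twist p (h, k) (i, j)"
    unfolding twist_def fst_conv snd_conv S
    by (simp only: if_simps mult.commute[of "p k" "p j"]) (rule 1; rule q2_pow_inv sgn_bit_square)
  show "i < h \<Longrightarrow> j < k \<Longrightarrow> (twist p (i, j) (h, k) :: ('n, 'k) laurent) =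
      sgn_bit (par p i j * par p h k) * q2_pow i h 1 * q2_pow j k (- 1) * twist p (h, k) (i, j)"
    unfolding twist_def fst_conv snd_conv S
    by (simp only: if_simps) (rule 2; rule sgn_bit_square)
  show "i < h \<Longrightarrow> j < k \<Longrightarrow> twist p (i, j) (h, k) * (hlam :: ('n, 'k) laurent) =
      sgn_bit (par p i j * par p i k) * (q1_pow p i 1 - q1_pow p i (- 1)) * q2_pow j k (- 1) * twist p (i, k) (h, j)"
    unfolding hlam_eq[of p i] twist_def fst_conv snd_conv S
    by (simp only: if_simps) (rule 3; rule sgn_bit_square)
qed

lemma sign_unit_identities:
  fixes s a b :: "'a::comm_ring_1"
  assumes "s * s = 1" "a * b = 1"
  shows "s * a * (s * a) = 1 + s * (a - b) * (s * a)" "s * a * (s * b) = 1"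
proof -
  have "s * a * (s * a) = (s * s) * (a * a)" "s * (a - b) * (s * a) = (s * s) * (a * a) - (s * s) * (a * b)"
    "s * a * (s * b) = (s * s) * (a * b)"
    by (simp_all add: algebra_simps)
  then show "s * a * (s * a) = 1 + s * (a - b) * (s * a)" "s * a * (s * b) = 1"
    unfolding assms by simp_all
qed

lemma qmat_rep_laurent: "qmat_rep (hQ p 1) (hQ p (- 1)) hlam p"
proof
  fix i j
  have q: "q1_pow p i 1 * q1_pow p i (- 1) = 1" by (simp add: q1_pow_mult q1_pow_0)
  show "hQ p 1 i * hQ p 1 i = 1 + hlam * hQ p 1 i" "hQ p 1 i * hQ p (- 1) i = 1"
    unfolding hQ_def hlam_eq[of p i] by (rule sign_unit_identities[OF sgn_bit_square q])+
  show "hQ p 1 i = hQ p 1 j" if "p i = p j"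
    using that by (simp add: hQ_def q1_pow_def)
  show "hQ p 1 i * hQ p 1 j = - 1" if "p i \<noteq> p j"
    using that bits[of "p i"] bits[of "p j"]
    by (auto simp: hQ_def q1_pow_def sgn_bit_def var_pow_mult var_pow_0)
qed

lemma prod_power_dvd_1: "(\<And>g. t g dvd (1::'k::comm_semiring_1)) \<Longrightarrow> (\<Prod>g\<in>S. t g ^ e g) dvd 1"
proof (induction S rule: infinite_finite_induct)
  case (insert g S)
  then have "t g ^ e g dvd 1" using dvd_power_same[of "t g" 1 "e g"] by simp
  then show ?case using insert by (simp add: dvd_1_mult)
qed simp_all

section \<open>Words applied to the vacuum vector\<close>

definition word_wt :: "('n::{finite, linorder} \<times> 'n) list \<Rightarrow> nat"
  where "word_wt w = (\<Sum>g\<leftarrow>w. wt g)"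

definition vac :: "('g \<Rightarrow> nat) \<Rightarrow> 'k::comm_ring_1"
  where "vac e = (if e = (\<lambda>_. 0) then 1 else 0)"

lemma exp_wt_count: "exp_wt (count_list w) = word_wt w"
proof (induction w)
  case (Cons g w)
  have "count_list (g # w) = (count_list w)(g := Suc (count_list w g))" by auto
  then show ?case using Cons by (simp only: exp_wt_Suc) (simp add: word_wt_def)
qed (simp add: exp_wt_def word_wt_def)

context qmat_rep
begin

lemma leadD:
  assumes "lead g T u"
  shows "truncated e \<Longrightarrow> u e dvd 1"
    and "bounded_by w f \<Longrightarrow> bounded_by (w + wt g) (endo_app T f)"
    and "bounded_by w f \<Longrightarrow> exp_wt e = w + wt g \<Longrightarrow> truncated e \<Longrightarrow>
      endo_app T f e = u e * endo_app (A_op g) f e"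
  using assms unfolding lead_def by blast+

text \<open>\<open>T_op t\<close> acts before \<open>g\<close> is raised, so its value is taken at
  the exponent lowered by one in \<open>g\<close>; that value is a product of units.\<close>

lemma lead_T:
  assumes "lead g T u" "\<And>g. t g dvd 1"
  shows "lead g (T * T_op t) (\<lambda>e. u e * (\<Prod>g'\<in>UNIV. t g' ^ (e(g := e g - 1)) g'))"
  unfolding lead_def
proof (intro conjI allI impI)
  show "u e * (\<Prod>g'\<in>UNIV. t g' ^ (e(g := e g - 1)) g') dvd 1" if "truncated e" for e
    using assms(2) leadD(1)[OF assms(1) that] by (intro dvd_1_mult prod_power_dvd_1)
next
  fix w :: nat and f :: "('n \<times> 'n \<Rightarrow> nat) \<Rightarrow> 'k" and e :: "'n \<times> 'n \<Rightarrow> nat"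
  assume "bounded_by w f"
  then have b: "bounded_by w (endo_app (T_op t) f)" by (simp add: bounded_by_def T_app)
  show "bounded_by (w + wt g) (endo_app (T * T_op t) f)"
    unfolding endo_app_simps by (rule leadD(2)[OF assms(1) b])
  have "endo_app (A_op g) (endo_app (T_op t) f) e
      = (\<Prod>g'\<in>UNIV. t g' ^ (e(g := e g - 1)) g') * endo_app (A_op g) f e"
    by (simp add: A_op_def loc_app T_app del: fun_upd_apply)
  then show "endo_app (T * T_op t) f e =
      u e * (\<Prod>g'\<in>UNIV. t g' ^ (e(g := e g - 1)) g') * endo_app (A_op g) f e"
    if "exp_wt e = w + wt g" "truncated e"
    unfolding endo_app_simps leadD(3)[OF assms(1) b that] by (simp only: mult.assoc)
qed

text \<open>Each letter increases the weight bound by its own weight and, in top weight, raises its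
  exponent up to a unit. Starting from the vacuum, only the exponent that counts the letters
  survives there.\<close>

lemma lead_word:
  assumes "\<And>g. \<exists>u. lead g (x g) u"
  shows "bounded_by (word_wt w) (endo_app (eval_word x (Wd w)) vac) \<and>
    (\<forall>e. truncated e \<longrightarrow> exp_wt e = word_wt w \<longrightarrow>
      (if e = count_list w then endo_app (eval_word x (Wd w)) vac e dvd 1
       else endo_app (eval_word x (Wd w)) vac e = 0))"
proof (induction w)
  case Nil
  have "exp_wt e = 0" if "e = (\<lambda>_. 0)" for e :: "'n \<times> 'n \<Rightarrow> nat"
    using that by (simp add: exp_wt_def)
  then show ?case
    by (auto simp: eval_word_def endo_app_simps bounded_by_def vac_def word_wt_def)
next
  case (Cons g w)
  let ?F = "endo_app (eval_word x (Wd w)) vac"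
  obtain u where u: "lead g (x g) u" using assms by blast
  have F: "endo_app (eval_word x (Wd (g # w))) vac = endo_app (x g) ?F"
    by (simp add: eval_word_def endo_app_simps)
  have w: "word_wt (g # w) = word_wt w + wt g" by (simp add: word_wt_def)
  have b: "bounded_by (word_wt w) ?F" using Cons by blast
  have "if e = count_list (g # w) then endo_app (x g) ?F e dvd 1 else endo_app (x g) ?F e = 0"
    if e: "truncated e" "exp_wt e = word_wt w + wt g" for e
  proof -
    have *: "endo_app (x g) ?F e = u e * (if e g = 0 then 0 else ?F (e(g := e g - 1)))"
      using leadD(3)[OF u b e(2,1)] e(1)[unfolded truncated_def, rule_format, of g]
      by (simp add: A_op_def loc_app)
    show ?thesis
    proof (cases "e g = 0")
      case True
      then have "e \<noteq> count_list (g # w)" by auto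
      then show ?thesis using * True by simp
    next
      case False
      let ?e = "e(g := e g - 1)"
      have "truncated ?e" using e(1) by (auto simp: truncated_def ok_def)
      moreover have "exp_wt ?e = word_wt w" using exp_wt_pred[of e g] False e(2) by simp
      moreover have "e = count_list (g # w) \<longleftrightarrow> ?e = count_list w"
      proof
        assume h: "?e = count_list w"
        show "e = count_list (g # w)"
        proof
          show "e g' = count_list (g # w) g'" for g'
            using fun_cong[OF h, of g'] False by (cases "g' = g") auto
        qed
      qed auto
      moreover have "u e dvd 1" by (rule leadD(1)[OF u e(1)])
      ultimately show ?thesis using Cons * False by (auto intro: dvd_1_mult)
    qed
  qed
  moreover have "bounded_by (word_wt w + wt g) (endo_app (x g) ?F)"
    by (rule leadD(2)[OF u b])
  ultimately show ?case unfolding F w by blast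
qed

text \<open>Moving T_a past x_b costs the scalar t a b, and the diagonal operators combine into
  one.\<close>

lemma twisted_mult:
  fixes x :: "'n \<times> 'n \<Rightarrow> ('n \<times> 'n \<Rightarrow> nat, 'k) endo" and t :: "'n \<times> 'n \<Rightarrow> 'n \<times> 'n \<Rightarrow> 'k"
  assumes "T_op (t a) * x b = t a b \<star> (x b * T_op (t a))"
  shows "(x a * T_op (t a)) * (x b * T_op (t b)) = t a b \<star> (x a * x b * T_op (\<lambda>g. t a g * t b g))"
  by (simp add: mult.assoc T_T[symmetric] assms[THEN assoc_ext] sc_mult_left sc_mult_right)

end

lemma twist_dvd_1: "(twist p a b :: ('n::linorder, 'k::field_char_0) laurent) dvd 1"
  unfolding twist_def by (simp add: dvd_1_mult sgn_bit_dvd_1 pow_dvd_1)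

lemma twist_bimult:
  "twist p a (i, j) * twist p a (h, k) = twist p a (i, k) * twist p a (h, j)"
  "twist p (i, j) a * twist p (h, k) a = twist p (i, k) a * twist p (h, j) a"
  by (simp_all add: twist_def ac_simps)

text \<open>The functional sends f to the value at \<open>e\<close> of f applied to the vacuum,
  where x_a acts as the twisted operator.\<close>

lemma eval_functional_exists:
  fixes p :: "'n::{finite, linorder} \<Rightarrow> bit"
  obtains \<phi> :: "('n, 'k::field_char_0) mat_free_alg \<Rightarrow> ('n \<times> 'n \<Rightarrow> nat) \<Rightarrow> ('n, 'k) laurent" where
    "\<And>f g e. \<phi> (f + g) e = \<phi> f e + \<phi> g e"
    "\<And>c f e. \<phi> (fa_const c * f) e = c * \<phi> f e"
    "\<And>f e. f \<in> mat_ideal p \<Longrightarrow> \<phi> f e = 0"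
    "\<And>w e. e \<in> truncated_exponents p \<Longrightarrow> word_wt w \<le> exp_wt e \<Longrightarrow> e \<noteq> count_list w \<Longrightarrow>
      \<phi> (Poly_Mapping.single (Wd w) 1) e = 0"
    "\<And>w. count_list w \<in> truncated_exponents p \<Longrightarrow>
      \<phi> (Poly_Mapping.single (Wd w) 1) (count_list w) dvd 1"
proof -
  interpret q: qmat_rep "hQ p 1 :: _ \<Rightarrow> ('n, 'k) laurent" "hQ p (- 1)" hlam p
    by (rule qmat_rep_laurent)
  obtain x where x: "q.good UNIV x" using q.good_upset[of UNIV] by auto
  let ?t = "twist p :: _ \<Rightarrow> _ \<Rightarrow> ('n, 'k) laurent"
  have bi: "q.bimult (?t a)" for a
    unfolding q.bimult_def
  proof (intro conjI allI)
    show "?t a g \<noteq> 0" for g using twist_dvd_1[of p a g, where ?'k = 'k] by auto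
  qed (rule twist_bimult(1))
  define z where "z a = x a * T_op (?t a)" for a
  have z_mult: "z a * z b = ?t a b \<star> (x a * x b * T_op (\<lambda>g. ?t a g * ?t b g))" for a b
    unfolding z_def using x bi[of a] by (intro q.twisted_mult) (simp add: q.good_def del: split_paired_All)
  have T: "T_op (\<lambda>g. ?t a g * ?t b g) = T_op (\<lambda>g. ?t b g * ?t a g)" for a b
    by (simp add: mult.commute)
  \<comment> \<open>The twist is multiplicative in rows and columns of its first argument too, so
    the tail carries the same diagonal operator as the main terms.\<close>
  have T2: "T_op (\<lambda>g. ?t (i, k) g * ?t (h, j) g) = T_op (\<lambda>g. ?t (i, j) g * ?t (h, k) g)" for i j h k
    by (simp add: twist_bimult(2)[of p i k _ h j])
  have rels: "q.qmat_rels UNIV x" using x by (simp add: q.good_def)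
  have sq: "x (i, j) * x (i, j) = 0" if "p i \<noteq> p j" for i j
    using rels that by (simp add: q.qmat_rels_def)
  have row: "x (i, j) * x (i, k) = hQ p 1 i \<star> (x (i, k) * x (i, j))" if "j < k" for i j k
    using rels that by (simp add: q.qmat_rels_def)
  have col: "x (i, j) * x (h, j) = hQ p 1 j \<star> (x (h, j) * x (i, j))" if "i < h" for i j h
    using rels that by (simp add: q.qmat_rels_def)
  have anti: "x (i, j) * x (h, k) = x (h, k) * x (i, j)" if "i < h" "k < j" for i j h k
    using rels that by (simp add: q.qmat_rels_def)
  have diag: "x (i, j) * x (h, k) = x (h, k) * x (i, j) + hlam \<star> (x (i, k) * x (h, j))" if "i < h" "j < k" for i j h k
    using rels that unfolding q.qmat_rels_def by blast
  have gg: "q.eval z (fa_gen a * fa_gen b) = z a * z b" for a b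
    by (simp add: q.eval_mult q.eval_gen)
  have ev: "q.eval z f = 0" if "f \<in> mat_rels p" for f
    using that unfolding mat_rels_def Let_def
  proof (elim UnE CollectE exE conjE)
    fix i j assume "f = fa_gen (i, j) * fa_gen (i, j)" "par p i j = 1"
    moreover from this have "p i \<noteq> p j" using bits[of "p i"] by (auto simp: par_def)
    ultimately show ?thesis by (simp add: gg z_mult sq)
  next
    fix i j k :: 'n
    assume "f = fa_gen (i, j) * fa_gen (i, k) - fa_const (sgn_bit (par p i j * par p i k) * q1_pow p i 1 *
      q2_pow j k (- 1)) * (fa_gen (i, k) * fa_gen (i, j))" and l: "j < k"
    then show ?thesis
      by (simp only: q.eval_diff q.eval_const_mult gg z_mult row[OF l] q.sc_sc
          q.sc_mult_left T twist_row[OF l] diff_self)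
  next
    fix i j h :: 'n
    assume "f = fa_gen (i, j) * fa_gen (h, j) - fa_const (sgn_bit (par p i j * par p h j) * q1_pow p j 1 *
      q2_pow i h 1) * (fa_gen (h, j) * fa_gen (i, j))" and l: "i < h"
    then show ?thesis
      by (simp only: q.eval_diff q.eval_const_mult gg z_mult col[OF l] q.sc_sc
          q.sc_mult_left T twist_col[OF l] diff_self)
  next
    fix i j h k :: 'n
    assume "f = fa_gen (i, j) * fa_gen (h, k) - fa_const (sgn_bit (par p i j * par p h k) * q2_pow i h 1 *
      q2_pow j k (- 1)) * (fa_gen (h, k) * fa_gen (i, j))" and l: "i < h" "k < j"
    then show ?thesis
      by (simp only: q.eval_diff q.eval_const_mult gg z_mult anti[OF l] q.sc_sc
          q.sc_mult_left T twist_anti[OF l] diff_self)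
  next
    fix i j h k :: 'n
    assume f: "f = fa_gen (i, j) * fa_gen (h, k) - (fa_const (sgn_bit (par p i j * par p h k) * q2_pow i h 1 *
      q2_pow j k (- 1)) * (fa_gen (h, k) * fa_gen (i, j)) + fa_const (sgn_bit (par p i j * par p i k) *
      (q1_pow p i 1 - q1_pow p i (- 1)) * q2_pow j k (- 1)) * (fa_gen (i, k) * fa_gen (h, j)))"
      and l: "i < h" "j < k"
    let ?T = "T_op (\<lambda>g. ?t (i, j) g * ?t (h, k) g)"
    have "z (i, j) * z (h, k) = ?t (i, j) (h, k) \<star> (x (h, k) * x (i, j) * ?T)
        + (?t (i, j) (h, k) * hlam) \<star> (x (i, k) * x (h, j) * ?T)"
      by (simp only: z_mult diag[OF l] distrib_right q.sc_add_right q.sc_mult_left q.sc_sc)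
    moreover have "z (h, k) * z (i, j) = ?t (h, k) (i, j) \<star> (x (h, k) * x (i, j) * ?T)"
      unfolding z_mult T[of "(h, k)" "(i, j)"] ..
    moreover have "z (i, k) * z (h, j) = ?t (i, k) (h, j) \<star> (x (i, k) * x (h, j) * ?T)"
      unfolding z_mult T2[of i k h j] ..
    ultimately show ?thesis
      unfolding f q.eval_diff q.eval_add q.eval_const_mult gg q.sc_sc twist_tail[OF l]
      by (simp only: q.sc_sc twist_diag[OF l] diff_self)
  qed
  \<comment> \<open>The kernel of the evaluation is a two-sided ideal containing the relations,
    hence it contains the ideal they generate.\<close>
  have "ideal {f. q.eval z f = 0} ring_of_type_algebra"
    by (rule ideal_ring_of_typeI) (simp_all add: q.eval_zero q.eval_add q.eval_mult)
  then have ker: "q.eval z f = 0" if "f \<in> mat_ideal p" for f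
    using ev that ring.genideal_minimal[OF ring_of_type, of "{f. q.eval z f = 0}" "mat_rels p"]
    unfolding mat_ideal_def by blast
  have lead: "\<exists>u. q.lead g (z g) u" for g
  proof -
    obtain u where "q.lead g (x g) u" using x unfolding q.good_def by blast
    from q.lead_T[OF this, of "?t g"] twist_dvd_1 show ?thesis unfolding z_def by blast
  qed
  note word = q.lead_word[of z, OF lead]
  have trunc: "q.truncated e \<longleftrightarrow> e \<in> truncated_exponents p" for e
  proof -
    have "par p i j = 1 \<longleftrightarrow> p i \<noteq> p j" for i j
      using bits[of "p i"] bits[of "p j"] by (auto simp: par_def)
    then show ?thesis by (simp add: q.truncated_def q.ok_def truncated_exponents_def)
  qed
  have sing: "q.eval z (Poly_Mapping.single (Wd w) 1) = eval_word z (Wd w)" for w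
    by (simp add: q.eval_single q.sc_one)
  show ?thesis
  proof (rule that[of "\<lambda>f. endo_app (q.eval z f) vac"])
    \<comment> \<open>Below the weight of \<open>e\<close> the bound on the support suffices; in
      equal weight the off-diagonal case of \<open>lead_word\<close> applies.\<close>
    show "endo_app (q.eval z (Poly_Mapping.single (Wd w) 1)) vac e = 0"
      if "e \<in> truncated_exponents p" "word_wt w \<le> exp_wt e" "e \<noteq> count_list w" for w e
      using word[of w] that trunc[of e] unfolding sing q.bounded_by_def
      by (cases "word_wt w = exp_wt e") auto
    show "endo_app (q.eval z (Poly_Mapping.single (Wd w) 1)) vac (count_list w) dvd 1"
      if "count_list w \<in> truncated_exponents p" for w
      using word[of w] that trunc[of "count_list w"] exp_wt_count[of w] unfolding sing by simp
  qed (simp_all add: q.eval_add q.eval_const_mult endo_app_simps ker)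
qed

section \<open>Spanning\<close>

definition word :: "'g list \<Rightarrow> ('g, 'r::comm_ring_1) free_alg"
  where "word w = Poly_Mapping.single (Wd w) 1"

lemma word_append: "word (u @ v) = word u * word v"
  by (simp add: word_def mult_single plus_wd_def)

lemma word_Nil: "word [] = 1"
  by (simp add: word_def flip: zero_wd_def)

lemma fa_gen_word: "fa_gen g = word [g]"
  by (simp add: fa_gen_def word_def)

lemma word_Cons: "word (g # w) = fa_gen g * word w"
  using word_append[of "[g]" w] by (simp add: fa_gen_word)

lemma fa_const_simps: "fa_const (c * d) = fa_const c * fa_const d" "fa_const 1 = 1" "fa_const 0 = 0"
  "fa_const (c + d) = fa_const c + fa_const d" "fa_const (- c) = - fa_const c"
  by (simp_all add: fa_const_def mult_single single_add single_uminus)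

lemma fa_const_commute: "f * fa_const c = fa_const c * f"
  for f :: "('g, 'r::comm_ring_1) free_alg"
proof -
  have "Poly_Mapping.single w d * fa_const c = fa_const c * Poly_Mapping.single w d" for w :: "'g wd" and d :: 'r
    by (simp add: fa_const_def mult_single mult.commute)
  then have "(\<Sum>w\<in>Poly_Mapping.keys f. Poly_Mapping.single w (Poly_Mapping.lookup f w)) * fa_const c
    = fa_const c * (\<Sum>w\<in>Poly_Mapping.keys f. Poly_Mapping.single w (Poly_Mapping.lookup f w))"
    unfolding sum_distrib_left sum_distrib_right by simp
  then show ?thesis by (simp flip: poly_mapping_sum_single)
qed

lemma free_alg_sum_words: "f = (\<Sum>w\<in>Poly_Mapping.keys f. fa_const (Poly_Mapping.lookup f w) * word (letters w))"
  by (subst poly_mapping_sum_single) (simp add: fa_const_def word_def mult_single)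

lemma ideal_mat_ideal: "ideal (mat_ideal p) ring_of_type_algebra"
  unfolding mat_ideal_def by (rule ring.genideal_ideal[OF ring_of_type]) simp

lemma
  shows mat_ideal_0: "0 \<in> mat_ideal p"
    and mat_ideal_add: "a \<in> mat_ideal p \<Longrightarrow> b \<in> mat_ideal p \<Longrightarrow> a + b \<in> mat_ideal p"
    and mat_ideal_left: "a \<in> mat_ideal p \<Longrightarrow> x * a \<in> mat_ideal p"
    and mat_ideal_right: "a \<in> mat_ideal p \<Longrightarrow> a * x \<in> mat_ideal p"
    and mat_ideal_rels: "a \<in> mat_rels p \<Longrightarrow> a \<in> mat_ideal p"
proof -
  interpret ideal "mat_ideal p" ring_of_type_algebra by (rule ideal_mat_ideal)
  show "0 \<in> mat_ideal p" using additive_subgroup.zero_closed[OF additive_subgroup_axioms] by simp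
  show "a \<in> mat_ideal p \<Longrightarrow> b \<in> mat_ideal p \<Longrightarrow> a + b \<in> mat_ideal p" using additive_subgroup.a_closed[OF additive_subgroup_axioms, of a b] by simp
  show "a \<in> mat_ideal p \<Longrightarrow> x * a \<in> mat_ideal p" using I_l_closed[of a x] by simp
  show "a \<in> mat_ideal p \<Longrightarrow> a * x \<in> mat_ideal p" using I_r_closed[of a x] by simp
  show "a \<in> mat_rels p \<Longrightarrow> a \<in> mat_ideal p"
    using genideal_self[of "mat_rels p"] unfolding mat_ideal_def by auto
qed

lemma mat_ideal_minus: "a \<in> mat_ideal p \<Longrightarrow> - a \<in> mat_ideal p"
  using mat_ideal_left[of a p "- 1"] by simp

text \<open>Exactly one relation has its left side equal to the two letters in lexicographic order.
  The coefficient is recorded as a unit so that the relation can be solved for the reversed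
  product.\<close>

lemma swap_less:
  fixes p :: "'n::{finite, linorder} \<Rightarrow> bit"
  assumes "a < b"
  shows "\<exists>c d x y. (word [a, b] :: ('n, 'k::field_char_0) mat_free_alg)
      - (fa_const c * word [b, a] + fa_const d * word [x, y]) \<in> mat_ideal p
    \<and> c dvd 1 \<and> (d = 0 \<or> wt x + wt y < wt a + wt b)"
proof -
  obtain i j h k where ab: "a = (i, j)" "b = (h, k)" by (cases a, cases b)
  have word2: "word [x, y] = (fa_gen x * fa_gen y :: ('n, 'k) mat_free_alg)" for x y
    by (simp add: fa_gen_word flip: word_append)
  \<comment> \<open>The first three kinds of relation correspond to d = 0, with arbitrary letters x
    and y.\<close>
  have no_tail: ?thesis
    if "(fa_gen a * fa_gen b :: ('n, 'k) mat_free_alg) - fa_const c * (fa_gen b * fa_gen a) \<in> mat_rels p" "c dvd 1" for c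
    using mat_ideal_rels[OF that(1)] that(2)
    by (intro exI[of _ c] exI[of _ 0]) (simp add: word2 fa_const_simps)
  consider "i = h" "j < k" | "i < h" "j = k" | "i < h" "k < j" | "i < h" "j < k"
    using assms unfolding ab by (cases h i rule: linorder_cases; cases j k rule: linorder_cases) auto
  then show ?thesis
  proof cases
    case 1
    let ?c = "sgn_bit (par p i j * par p i k) * q1_pow p i 1 * q2_pow j k (- 1)"
    have "(fa_gen a * fa_gen b :: ('n, 'k) mat_free_alg) - fa_const ?c * (fa_gen b * fa_gen a) \<in> mat_rels p"
      using 1 unfolding ab mat_rels_def Let_def by blast
    then show ?thesis by (rule no_tail) (intro dvd_1_mult sgn_bit_dvd_1 pow_dvd_1)
  next
    case 2
    let ?c = "sgn_bit (par p i j * par p h j) * q1_pow p j 1 * q2_pow i h 1"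
    have "(fa_gen a * fa_gen b :: ('n, 'k) mat_free_alg) - fa_const ?c * (fa_gen b * fa_gen a) \<in> mat_rels p"
      using 2 unfolding ab mat_rels_def Let_def by blast
    then show ?thesis by (rule no_tail) (intro dvd_1_mult sgn_bit_dvd_1 pow_dvd_1)
  next
    case 3
    let ?c = "sgn_bit (par p i j * par p h k) * q2_pow i h 1 * q2_pow j k (- 1)"
    have "(fa_gen a * fa_gen b :: ('n, 'k) mat_free_alg) - fa_const ?c * (fa_gen b * fa_gen a) \<in> mat_rels p"
      using 3 unfolding ab mat_rels_def Let_def by blast
    then show ?thesis by (rule no_tail) (intro dvd_1_mult sgn_bit_dvd_1 pow_dvd_1)
  next
    case 4
    let ?c = "sgn_bit (par p i j * par p h k) * q2_pow i h 1 * q2_pow j k (- 1) :: ('n, 'k) laurent"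
    let ?d = "sgn_bit (par p i j * par p i k) * (q1_pow p i 1 - q1_pow p i (- 1)) * q2_pow j k (- 1) :: ('n, 'k) laurent"
    have "word [a, b] - (fa_const ?c * word [b, a] + fa_const ?d * word [(i, k), (h, j)]) \<in> mat_rels p"
      using 4 unfolding word2 ab mat_rels_def Let_def by blast
    moreover have "?c dvd 1" by (intro dvd_1_mult sgn_bit_dvd_1 pow_dvd_1)
    moreover have "wt (i, k) + wt (h, j) < wt a + wt b" using wt_diag[OF 4] by (simp add: ab)
    ultimately show ?thesis using mat_ideal_rels by blast
  qed
qed

lemma swap:
  fixes p :: "'n::{finite, linorder} \<Rightarrow> bit"
  assumes "a \<noteq> b"
  shows "\<exists>c d x y. (word [a, b] :: ('n, 'k::field_char_0) mat_free_alg)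
      - (fa_const c * word [b, a] + fa_const d * word [x, y]) \<in> mat_ideal p
    \<and> (d = 0 \<or> wt x + wt y < wt a + wt b)"
proof (cases "a < b")
  case True
  then show ?thesis using swap_less by blast
next
  case False
  then have "b < a" using assms by simp
  from swap_less[OF this, of p] obtain c d x y where
    *: "(word [b, a] :: ('n, 'k) mat_free_alg) - (fa_const c * word [a, b] + fa_const d * word [x, y]) \<in> mat_ideal p"
    and "c dvd 1" and xy: "d = 0 \<or> wt x + wt y < wt b + wt a"
    by blast
  then obtain c' where c: "c * c' = 1" by (metis dvdE)
  have c': "fa_const c' * (fa_const c * f) = f" for f :: "('n, 'k) mat_free_alg"
    using c by (simp add: mult.commute[of c'] flip: mult.assoc fa_const_simps(1)) (simp add: fa_const_simps)
  \<comment> \<open>Multiplying by - c' solves the relation for the product in the other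
    order.\<close>
  have "- (fa_const c' * (word [b, a] - (fa_const c * word [a, b] + fa_const d * word [x, y])))
    = (word [a, b] :: ('n, 'k) mat_free_alg) - (fa_const c' * word [b, a] + fa_const (- (c' * d)) * word [x, y])"
    by (simp add: fa_const_simps right_diff_distrib distrib_left mult.assoc c')
  moreover note mat_ideal_minus[OF mat_ideal_left[OF *, of "fa_const c'"]]
  ultimately have "(word [a, b] :: ('n, 'k) mat_free_alg)
      - (fa_const c' * word [b, a] + fa_const (- (c' * d)) * word [x, y]) \<in> mat_ideal p"
    by simp
  moreover have "- (c' * d) = 0 \<or> wt x + wt y < wt a + wt b" using xy by auto
  ultimately show ?thesis by blast
qed

definition mono_word :: "('g \<times> 'g) set \<Rightarrow> ('g \<Rightarrow> nat) \<Rightarrow> 'g list"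
  where "mono_word r e = concat (map (\<lambda>g. replicate (e g) g) (order_list r))"

lemma count_mono_word:
  fixes r :: "('g::finite \<times> 'g) set"
  assumes "linear_order r"
  shows "count_list (mono_word r e) = e"
proof
  fix g
  have "count_list (replicate n g') g = (if g' = g then n else 0)" for n and g' :: 'g
    by (induction n) auto
  then have *: "count_list (concat (map (\<lambda>g. replicate (e g) g) gs)) g = (if g \<in> set gs then e g else 0)"
    if "distinct gs" for gs
    using that by (induction gs) auto
  then show "count_list (mono_word r e) g = e g"
    using order_list_correct[OF assms] by (simp add: mono_word_def)
qed

text \<open>Words are sorted modulo lower weight. Stating this for an arbitrary subspace
  \<open>W\<close> avoids explicit linear combinations; later \<open>W\<close> is the preimage of a
  set closed under the module operations.\<close>

lemma words_span:
  fixes p :: "'n::{finite, linorder} \<Rightarrow> bit" and W :: "('n, 'k::field_char_0) mat_free_alg set"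
  assumes r: "linear_order r"
    and ideal: "mat_ideal p \<subseteq> W"
    and add: "\<And>f g. f \<in> W \<Longrightarrow> g \<in> W \<Longrightarrow> f + g \<in> W"
    and scale: "\<And>c f. f \<in> W \<Longrightarrow> fa_const c * f \<in> W"
    and mono: "\<And>e. e \<in> truncated_exponents p \<Longrightarrow> word (mono_word r e) \<in> W"
  shows "f \<in> W"
proof -
  have "word w \<in> W" for w
  proof (induction "word_wt w" arbitrary: w rule: less_induct)
    case less
    define N where "N = word_wt w"
    have lower: "word v \<in> W" if "word_wt v < N" for v
      using less that by (simp add: N_def)
    \<comment> \<open>Exchanging neighbours changes a word by a unit multiple at most and by a tail
      of smaller weight, which is in \<open>W\<close> by the induction hypothesis.\<close>
    have swap: "word (u @ a # b # v) \<in> W"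
      if "word (u @ b # a # v) \<in> W" "word_wt (u @ a # b # v) = N" for u v a b
    proof (cases "a = b")
      case False
      from swap[OF this, of p] obtain c d x y where
        *: "(word [a, b] :: ('n, 'k) mat_free_alg) - (fa_const c * word [b, a] + fa_const d * word [x, y]) \<in> mat_ideal p"
        and xy: "d = 0 \<or> wt x + wt y < wt a + wt b"
        by blast
      let ?i = "(word [a, b] :: ('n, 'k) mat_free_alg) - (fa_const c * word [b, a] + fa_const d * word [x, y])"
      have words: "word (u @ x # y # v) = word u * (word [x, y] * word v)" for x y
        by (simp flip: word_append)
      have comm: "word u * (fa_const c * f) = fa_const c * (word u * f)" for c and f :: "('n, 'k) mat_free_alg"
        by (simp only: fa_const_commute flip: mult.assoc)
      have "fa_const d * word (u @ x # y # v) \<in> W"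
      proof (cases "d = 0")
        case True
        then show ?thesis using ideal mat_ideal_0[of p] by (auto simp: fa_const_simps)
      next
        case False
        then show ?thesis using xy that(2) by (intro scale lower) (simp add: word_wt_def)
      qed
      moreover have "word u * (?i * word v) \<in> W"
        using ideal mat_ideal_left[OF mat_ideal_right[OF *, of "word v"], of "word u"] by blast
      ultimately have "word u * (?i * word v) + (fa_const c * word (u @ b # a # v) + fa_const d * word (u @ x # y # v)) \<in> W"
        using scale[OF that(1), of c] by (intro add)
      also have "word u * (?i * word v) + (fa_const c * word (u @ b # a # v) + fa_const d * word (u @ x # y # v))
        = word (u @ a # b # v)"
        unfolding words
        by (simp add: left_diff_distrib right_diff_distrib distrib_left distrib_right mult.assoc comm)
      finally show ?thesis .
    qed (use that in simp)
    have move: "word (u @ s @ a # v) \<in> W"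
      if "word (u @ a # s @ v) \<in> W" "word_wt (u @ a # s @ v) = N" for u s a v
      using that
    proof (induction s arbitrary: u)
      case (Cons b s)
      have "word_wt (u @ b # a # s @ v) = N" using Cons.prems(2) by (simp add: word_wt_def)
      with Cons.prems(1) have "word ((u @ [b]) @ a # s @ v) \<in> W" by (auto intro: swap)
      from Cons.IH[OF this] \<open>word_wt (u @ b # a # s @ v) = N\<close> show ?case by simp
    qed simp
    \<comment> \<open>All rearrangements have the fixed weight N; the first letter of the target is
      found in \<open>v\<close> and moved to the front.\<close>
    have perm: "word (u @ v) \<in> W"
      if "mset v = mset v'" "word (u @ v') \<in> W" "word_wt (u @ v) = N" for u v v'
      using that
    proof (induction v' arbitrary: u v)
      case (Cons a t)
      then have "a \<in> set v" by (metis list.set_intros(1) set_mset_mset)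
      then obtain s1 s2 where v: "v = s1 @ a # s2" by (meson split_list)
      have "word ((u @ [a]) @ (s1 @ s2)) \<in> W"
        by (rule Cons.IH) (use Cons.prems v in \<open>simp_all add: word_wt_def\<close>)
      then show ?case
        using move[of u a s1 s2] Cons.prems(3) by (simp add: v word_wt_def)
    qed simp
    show ?case
    proof (cases "count_list w \<in> truncated_exponents p")
      case True
      have "mset w = mset (mono_word r (count_list w))"
        by (rule multiset_eqI) (simp add: count_mset count_mono_word[OF r])
      from perm[OF this, of "[]"] mono[OF True] show ?thesis by (simp add: N_def)
    next
      case False
      then obtain i j where ij: "par p i j = 1" "2 \<le> count_list w (i, j)"
        by (auto simp: truncated_exponents_def not_le)
      define w' where "w' = filter (\<lambda>g. g \<noteq> (i, j)) w"
      obtain m where m: "count_list w (i, j) = Suc (Suc m)"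
        using ij(2) by (metis Suc_le_D numeral_2_eq_2 Suc_le_mono)
      \<comment> \<open>Two copies of an odd letter are brought to the front, where their product is
        a relation.\<close>
      have e: "mset w = mset ((i, j) # (i, j) # replicate m (i, j) @ w')"
        by (rule multiset_eqI) (use m in \<open>auto simp: w'_def simp flip: count_mset\<close>)
      have "fa_gen (i, j) * fa_gen (i, j) \<in> mat_ideal p"
        using ij(1) by (intro mat_ideal_rels) (auto simp: mat_rels_def Let_def)
      then have "word ((i, j) # (i, j) # replicate m (i, j) @ w') \<in> W"
        using ideal mat_ideal_right unfolding word_Cons[of "(i, j)"] mult.assoc[symmetric] by blast
      then show ?thesis using perm[OF e, of "[]"] by (simp add: N_def)
    qed
  qed
  then have "(\<Sum>w\<in>S. fa_const (c w) * word (letters w)) \<in> W" for S and c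
    using ideal mat_ideal_0[of p]
    by (induction S rule: infinite_finite_induct) (auto intro: add scale)
  then show ?thesis by (subst free_alg_sum_words)
qed

section \<open>Bases and extension of scalars\<close>

text \<open>Functionals that are triangular with nonzero diagonal separate the family over a domain.
  Spanning is given as a closure principle, the form in which it is proved for both modules.\<close>

lemma triangular_basis:
  fixes M :: "('r::idom, 'a, 'z) module_scheme" and x :: "'e \<Rightarrow> 'a" and rank :: "'e \<Rightarrow> nat"
    and L :: "'e \<Rightarrow> 'a \<Rightarrow> 'r"
  assumes M: "Module.module ring_of_type_algebra M"
    and x: "\<And>e. e \<in> E \<Longrightarrow> x e \<in> carrier M"
    and L_add: "\<And>e u v. u \<in> carrier M \<Longrightarrow> v \<in> carrier M \<Longrightarrow> L e (u \<oplus>\<^bsub>M\<^esub> v) = L e u + L e v"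
    and L_smult: "\<And>e c u. u \<in> carrier M \<Longrightarrow> L e (c \<odot>\<^bsub>M\<^esub> u) = c * L e u"
    and diag: "\<And>e. e \<in> E \<Longrightarrow> L e (x e) \<noteq> 0"
    and triangular: "\<And>e e'. e \<in> E \<Longrightarrow> e' \<in> E \<Longrightarrow> e \<noteq> e' \<Longrightarrow> rank e' \<le> rank e \<Longrightarrow> L e (x e') = 0"
    and spanning: "\<And>H. \<lbrakk>\<And>u v. u \<in> H \<Longrightarrow> v \<in> H \<Longrightarrow> u \<oplus>\<^bsub>M\<^esub> v \<in> H; \<And>c u. u \<in> H \<Longrightarrow> c \<odot>\<^bsub>M\<^esub> u \<in> H;
        \<zero>\<^bsub>M\<^esub> \<in> H; \<And>e. e \<in> E \<Longrightarrow> x e \<in> H; H \<subseteq> carrier M\<rbrakk> \<Longrightarrow> carrier M \<subseteq> H"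
  shows "inj_on x E" and "module_basis ring_of_type_algebra M (x ` E)"
proof -
  let ?R = "ring_of_type_algebra :: 'r ring"
  interpret Module.module ?R M by (rule M)
  have L_zero: "L e \<zero>\<^bsub>M\<^esub> = 0" for e
    using L_smult[of "\<zero>\<^bsub>M\<^esub>" e 0] by simp
  have L_finsum: "L e (\<Oplus>\<^bsub>M\<^esub>v\<in>A. a v \<odot>\<^bsub>M\<^esub> v) = (\<Sum>v\<in>A. a v * L e v)"
    if "finite A" "A \<subseteq> carrier M" for A a e
    using that
  proof (induction A rule: finite_induct)
    case (insert u A)
    then have "(\<Oplus>\<^bsub>M\<^esub>v\<in>insert u A. a v \<odot>\<^bsub>M\<^esub> v) = a u \<odot>\<^bsub>M\<^esub> u \<oplus>\<^bsub>M\<^esub> (\<Oplus>\<^bsub>M\<^esub>v\<in>A. a v \<odot>\<^bsub>M\<^esub> v)"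
      by (intro M.finsum_insert) (auto intro!: smult_closed)
    moreover have "(\<Oplus>\<^bsub>M\<^esub>v\<in>A. a v \<odot>\<^bsub>M\<^esub> v) \<in> carrier M"
      using insert by (intro M.finsum_closed) (auto intro!: smult_closed)
    ultimately show ?case
      using insert by (simp add: L_add L_smult smult_closed)
  qed (simp add: L_zero)
  show inj: "inj_on x E"
  proof (rule inj_onI, rule ccontr)
    fix e e' assume e: "e \<in> E" "e' \<in> E" "x e = x e'" "e \<noteq> e'"
    then show False
      using diag[of e] diag[of e'] triangular[of e e'] triangular[of e' e] by (cases "rank e' \<le> rank e") auto
  qed
  have sub: "x ` E \<subseteq> carrier M" using x by auto
  have "\<not> lin_dep (x ` E)"
  proof
    assume "lin_dep (x ` E)"
    then obtain A a v where A: "finite A" "A \<subseteq> x ` E" "lincomb a A = \<zero>\<^bsub>M\<^esub>" "v \<in> A" "a v \<noteq> 0"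
      unfolding lin_dep_def by auto
    then obtain F where F: "F \<subseteq> E" "inj_on x F" "A = x ` F" by (auto simp: subset_image_inj)
    have fF: "finite F" using A(1) F(2,3) finite_imageD by blast
    define G where "G = {e \<in> F. a (x e) \<noteq> 0}"
    have "finite G" "G \<noteq> {}" using fF A(4,5) F(3) by (auto simp: G_def)
    \<comment> \<open>At an index of maximal rank among the nonzero coefficients, the functional
      \<open>L e\<close> annihilates every other term.\<close>
    then obtain e where e: "e \<in> G" "\<And>e'. e' \<in> G \<Longrightarrow> rank e' \<le> rank e"
      using Max_in[of "rank ` G"] Max_ge[of "rank ` G"] by (metis (no_types, lifting) finite_imageI imageE image_eqI image_is_empty)
    have "0 = L e (lincomb a A)" using A(3) L_zero by simp
    also have "\<dots> = (\<Sum>e'\<in>F. a (x e') * L e (x e'))"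
      unfolding lincomb_def F(3) using A(1,2) F sub by (subst L_finsum) (auto simp: sum.reindex)
    also have "\<dots> = (\<Sum>e'\<in>F. if e' = e then a (x e) * L e (x e) else 0)"
    proof (rule sum.cong)
      fix e' assume "e' \<in> F"
      then show "a (x e') * L e (x e') = (if e' = e then a (x e) * L e (x e) else 0)"
        using e triangular[of e e'] F(1) by (auto simp: G_def)
    qed simp
    also have "\<dots> = a (x e) * L e (x e)" using fF e(1) by (simp add: G_def)
    finally show False using e(1) diag[of e] F(1) by (auto simp: G_def)
  qed
  moreover have "span (x ` E) = carrier M"
  proof
    have s: "LinearCombinations.submodule ?R (span (x ` E)) M" using sub by (rule span_is_submodule)
    show "carrier M \<subseteq> span (x ` E)"
    proof (rule spanning)
      show "x e \<in> span (x ` E)" if "e \<in> E" for e using in_own_span[OF sub] that by blast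
    qed (use s sub in \<open>auto simp: LinearCombinations.submodule_def\<close>)
  qed (rule span_is_subset2[OF sub])
  ultimately show "module_basis ?R M (x ` E)"
    unfolding module_basis_def using M sub by blast
qed

text \<open>Operations on cosets are defined as unions over all representatives; when the result is
  independent of the representative, the union is that common result.\<close>

lemma UN_eq_memberI:
  assumes "c \<in> A" "\<And>g. g \<in> A \<Longrightarrow> B g = B c"
  shows "(\<Union>g\<in>A. B g) = B c"
proof (rule subset_antisym; rule subsetI)
  fix z assume "z \<in> (\<Union>g\<in>A. B g)"
  then obtain g where "g \<in> A" "z \<in> B g" by (rule UN_E)
  then show "z \<in> B c" by (simp only: assms(2)[OF \<open>g \<in> A\<close>])
qed (rule UN_I[OF assms(1)])

section \<open>Tensor products with a field\<close>

locale scalar_extension =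
  fixes h :: "'r::comm_ring_1 \<Rightarrow> 'k::field" and M :: "('r, 'a) superalgebra"
  assumes M: "Module.module ring_of_type_algebra M"
begin

abbreviation R :: "'r ring" where "R \<equiv> ring_of_type_algebra"
abbreviation K :: "'k ring" where "K \<equiv> ring_of_type_algebra"
abbreviation G where "G \<equiv> tensor_free K M"
abbreviation N where "N \<equiv> tensor_kernel R K h M"
abbreviation V where "V \<equiv> scalar_ext R K h M"
abbreviation cl :: "('k \<times> 'a \<Rightarrow>\<^sub>0 int) \<Rightarrow> ('k \<times> 'a \<Rightarrow>\<^sub>0 int) set" where "cl f \<equiv> N #>\<^bsub>G\<^esub> f"
abbreviation pt where "pt \<equiv> pure_tensor R K h M"
abbreviation ext where "ext a \<equiv> frag_extend (\<lambda>(b, m). frag_of (a * b, m))"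

sublocale M: Module.module R M by (rule M)

sublocale G: comm_group G by (rule abelian_free_Abelian_group)

lemma frag_of_carrier: "m \<in> carrier M \<Longrightarrow> frag_of (a, m) \<in> carrier G"
  by simp

lemma carrier_diff: "f \<in> carrier G \<Longrightarrow> g \<in> carrier G \<Longrightarrow> f - g \<in> carrier G"
  using keys_diff[of f g] by (simp only: carrier_free_Abelian_group_iff) blast

lemma rels_carrier: "tensor_rels R K h M \<subseteq> carrier G"
  unfolding tensor_rels_def
  by (rule subsetI, elim UnE CollectE exE conjE; hypsubst;
      intro carrier_diff frag_of_carrier M.a_closed M.smult_closed; assumption)

lemma N_subgroup: "subgroup N G"
  unfolding tensor_kernel_def by (rule G.generate_is_subgroup[OF rels_carrier])

sublocale N: normal N G
  by (rule G.subgroup_imp_normal[OF N_subgroup])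

lemma N_carrier: "f \<in> N \<Longrightarrow> f \<in> carrier G"
  using N_subgroup subgroup.subset by blast

lemma N_induct [consumes 1, case_names zero rel minus add]:
  assumes "f \<in> N" "P 0" "\<And>f. f \<in> tensor_rels R K h M \<Longrightarrow> P f" "\<And>f. P f \<Longrightarrow> P (- f)"
    "\<And>f g. P f \<Longrightarrow> P g \<Longrightarrow> P (f + g)"
  shows "P f"
  using assms(1) unfolding tensor_kernel_def
proof (induction f rule: generate.induct)
  case (inv f)
  then have "f \<in> carrier G" using rels_carrier by blast
  then show ?case using assms(3)[OF inv] assms(4)[of f] by simp
qed (use assms in auto)

lemma
  shows N_0: "0 \<in> N" and N_add: "f \<in> N \<Longrightarrow> g \<in> N \<Longrightarrow> f + g \<in> N"
    and N_minus: "f \<in> N \<Longrightarrow> - f \<in> N" and N_rels: "f \<in> tensor_rels R K h M \<Longrightarrow> f \<in> N"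
proof -
  show "0 \<in> N" using subgroup.one_closed[OF N_subgroup] by simp
  show "f \<in> N \<Longrightarrow> g \<in> N \<Longrightarrow> f + g \<in> N" using subgroup.m_closed[OF N_subgroup, of f g] by simp
  show "f \<in> N \<Longrightarrow> - f \<in> N" using subgroup.m_inv_closed[OF N_subgroup, of f] N_carrier[of f] by simp
  show "f \<in> tensor_rels R K h M \<Longrightarrow> f \<in> N" unfolding tensor_kernel_def by (rule generate.incl)
qed

lemma cl_eq: "cl f = {n + f | n. n \<in> N}"
  by (auto simp: r_coset_def)

lemma self_in_cl: "f \<in> cl f"
  unfolding cl_eq by (rule CollectI, rule exI[of _ 0]) (simp add: N_0)

lemma cl_eqI: "f - g \<in> N \<Longrightarrow> cl f = cl g"
proof -
  assume "f - g \<in> N"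
  then have "n + (f - g) \<in> N" "n + (g - f) \<in> N" if "n \<in> N" for n
    using that N_add[of n "f - g"] N_add[of n "- (f - g)"] N_minus[of "f - g"] by simp_all
  moreover have "n + f = (n + (f - g)) + g" "n + g = (n + (g - f)) + f" for n by simp_all
  ultimately show ?thesis unfolding cl_eq by blast
qed

lemma V_simps:
  "carrier V = cl ` carrier G" "\<zero>\<^bsub>V\<^esub> = cl 0"
  "f \<in> carrier G \<Longrightarrow> g \<in> carrier G \<Longrightarrow> cl f \<oplus>\<^bsub>V\<^esub> cl g = cl (f + g)"
proof -
  show "carrier V = cl ` carrier G"
    by (auto simp: scalar_ext_def Let_def FactGroup_def RCOSETS_def)
  show "\<zero>\<^bsub>V\<^esub> = cl 0"
    using cl_eq[of 0] by (simp add: scalar_ext_def Let_def FactGroup_def)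
  show "f \<in> carrier G \<Longrightarrow> g \<in> carrier G \<Longrightarrow> cl f \<oplus>\<^bsub>V\<^esub> cl g = cl (f + g)"
    using N.rcos_sum[of f g]
    by (simp add: scalar_ext_def Let_def FactGroup_def del: carrier_free_Abelian_group_iff ring_of_type_simps(1))
qed

lemma ext_carrier: "f \<in> carrier G \<Longrightarrow> ext a f \<in> carrier G"
proof -
  assume "f \<in> carrier G"
  then have "Poly_Mapping.keys f \<subseteq> carrier K \<times> carrier M" by simp
  then have "Poly_Mapping.keys (ext a f) \<subseteq> carrier K \<times> carrier M"
  proof (induction f rule: frag_induction)
    case (diff f g)
    then show ?case by (simp add: frag_extend_diff) (meson keys_diff order_trans le_sup_iff)
  qed auto
  then show ?thesis by simp
qed

lemma frag_additive_eq:
  assumes "f \<in> carrier G" "F 0 = (0 :: 'b::ab_group_add)" "\<And>f g. F (f - g) = F f - F g"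
    "\<And>b m. m \<in> carrier M \<Longrightarrow> F (frag_of (b, m)) = 0"
  shows "F f = 0"
proof -
  have "Poly_Mapping.keys f \<subseteq> carrier K \<times> carrier M" using assms(1) by simp
  then show ?thesis by (induction f rule: frag_induction) (use assms in auto)
qed

text \<open>Multiplying the first tensor factor turns each defining relation into one of the same
  kind, so the scalar action descends to the quotient.\<close>

lemma ext_N: "f \<in> N \<Longrightarrow> ext a f \<in> N"
proof (induction f rule: N_induct)
  case (rel f)
  then show ?case unfolding tensor_rels_def
  proof (elim UnE CollectE exE conjE)
    fix b c m assume "f = frag_of (b \<oplus>\<^bsub>K\<^esub> c, m) - frag_of (b, m) - frag_of (c, m)" "m \<in> carrier M"
    then have "ext a f = frag_of (a * b \<oplus>\<^bsub>K\<^esub> a * c, m) - frag_of (a * b, m) - frag_of (a * c, m)"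
      by (simp add: frag_extend_diff distrib_left)
    then show ?thesis using \<open>m \<in> carrier M\<close> by (intro N_rels) (auto simp: tensor_rels_def)
  next
    fix b m l assume "f = frag_of (b, m \<oplus>\<^bsub>M\<^esub> l) - frag_of (b, m) - frag_of (b, l)"
      "m \<in> carrier M" "l \<in> carrier M"
    then have "ext a f = frag_of (a * b, m \<oplus>\<^bsub>M\<^esub> l) - frag_of (a * b, m) - frag_of (a * b, l)"
      by (simp add: frag_extend_diff)
    then show ?thesis using \<open>m \<in> carrier M\<close> \<open>l \<in> carrier M\<close> by (intro N_rels) (auto simp: tensor_rels_def)
  next
    fix b c m assume "f = frag_of (b \<otimes>\<^bsub>K\<^esub> h c, m) - frag_of (b, c \<odot>\<^bsub>M\<^esub> m)" "m \<in> carrier M"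
    then have "ext a f = frag_of ((a * b) \<otimes>\<^bsub>K\<^esub> h c, m) - frag_of (a * b, c \<odot>\<^bsub>M\<^esub> m)"
      by (simp add: frag_extend_diff mult.assoc)
    then show ?thesis using \<open>m \<in> carrier M\<close> by (intro N_rels) (auto simp: tensor_rels_def)
  qed
qed (simp_all add: N_0 N_add N_minus frag_extend_add frag_extend_minus)

lemma V_smult: "a \<odot>\<^bsub>V\<^esub> cl f = cl (ext a f)" if "f \<in> carrier G"
proof -
  have "cl (ext a g) = cl (ext a f)" if "g \<in> cl f" for g
  proof -
    from that obtain n where n: "n \<in> N" "g = n + f" unfolding cl_eq mem_Collect_eq by (elim exE conjE)
    have "ext a g - ext a f = ext a n" unfolding n(2) frag_extend_add by simp
    with ext_N[OF n(1), of a] show ?thesis by (intro cl_eqI) (simp only:)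
  qed
  with self_in_cl have "(\<Union>g\<in>cl f. cl (ext a g)) = cl (ext a f)" by (rule UN_eq_memberI)
  then show ?thesis by (simp add: scalar_ext_def Let_def)
qed

lemma pt_cl: "pt a m = cl (frag_of (a, m))"
  by (simp add: pure_tensor_def)

lemma module_V: "Module.module K V"
proof (rule moduleI)
  have V: "P u" if "u \<in> carrier V" "\<And>f. f \<in> carrier G \<Longrightarrow> P (cl f)" for P u
    using that by (auto simp: V_simps)
  have add: "f + g \<in> carrier G" if "f \<in> carrier G" "g \<in> carrier G" for f g
    using G.m_closed[OF that] by simp
  have z: "0 \<in> carrier G" using G.one_closed by simp
  show "cring K" by (rule cring_from_type_algebra)
  show "abelian_group V"
  proof (rule abelian_groupI)
    fix u v w assume u: "u \<in> carrier V" and v: "v \<in> carrier V" and w: "w \<in> carrier V"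
    obtain f g k where f: "f \<in> carrier G" "g \<in> carrier G" "k \<in> carrier G" "u = cl f" "v = cl g" "w = cl k"
      using u v w unfolding V_simps(1) by blast
    show "u \<oplus>\<^bsub>V\<^esub> v \<in> carrier V"
      unfolding f(4,5) V_simps(3)[OF f(1,2)] using add[OF f(1,2)] by (simp only: V_simps(1) image_eqI)
    show "u \<oplus>\<^bsub>V\<^esub> v \<oplus>\<^bsub>V\<^esub> w = u \<oplus>\<^bsub>V\<^esub> (v \<oplus>\<^bsub>V\<^esub> w)"
      unfolding f(4-6) by (simp only: V_simps(3) f(1-3) add add.assoc)
    show "u \<oplus>\<^bsub>V\<^esub> v = v \<oplus>\<^bsub>V\<^esub> u"
      unfolding f(4-6) by (simp only: V_simps(3) f(1-3) add.commute)
  next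
    fix u assume "u \<in> carrier V"
    then obtain f where f: "f \<in> carrier G" "u = cl f" unfolding V_simps(1) by blast
    show "\<zero>\<^bsub>V\<^esub> \<oplus>\<^bsub>V\<^esub> u = u" unfolding f(2) V_simps(2) V_simps(3)[OF z f(1)] by simp
    have n: "- f \<in> carrier G" using f(1) by simp
    have "cl (- f) \<oplus>\<^bsub>V\<^esub> u = \<zero>\<^bsub>V\<^esub>" unfolding f(2) V_simps(2) V_simps(3)[OF n f(1)] by simp
    then show "\<exists>v\<in>carrier V. v \<oplus>\<^bsub>V\<^esub> u = \<zero>\<^bsub>V\<^esub>" using n unfolding V_simps(1) by blast
  qed (use z in \<open>simp only: V_simps(1,2) image_eqI\<close>)
  fix a b u v assume "u \<in> carrier V" "v \<in> carrier V"
  then obtain f g where f: "f \<in> carrier G" "g \<in> carrier G" "u = cl f" "v = cl g" unfolding V_simps(1) by blast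
  note e = ext_carrier[OF f(1)] ext_carrier[OF f(2)]
  show "a \<odot>\<^bsub>V\<^esub> u \<in> carrier V"
    unfolding f(3) V_smult[OF f(1)] V_simps(1) using e(1) by (rule imageI)
  show "a \<odot>\<^bsub>V\<^esub> (u \<oplus>\<^bsub>V\<^esub> v) = a \<odot>\<^bsub>V\<^esub> u \<oplus>\<^bsub>V\<^esub> a \<odot>\<^bsub>V\<^esub> v"
    unfolding f(3,4) by (simp only: V_simps(3) V_smult f(1,2) e add frag_extend_add)
  have "ext (a \<otimes>\<^bsub>K\<^esub> b) f - ext a (ext b f) = 0"
    by (rule frag_additive_eq[OF f(1)]) (simp_all add: frag_extend_diff mult.assoc)
  then show "(a \<otimes>\<^bsub>K\<^esub> b) \<odot>\<^bsub>V\<^esub> u = a \<odot>\<^bsub>V\<^esub> (b \<odot>\<^bsub>V\<^esub> u)"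
    unfolding f(3) by (simp only: V_smult f(1) e right_minus_eq)
  have "ext \<one>\<^bsub>K\<^esub> f - f = 0"
    by (rule frag_additive_eq[OF f(1)]) (simp_all add: frag_extend_diff)
  then show "\<one>\<^bsub>K\<^esub> \<odot>\<^bsub>V\<^esub> u = u"
    unfolding f(3) by (simp only: V_smult f(1) right_minus_eq)
  have "Poly_Mapping.keys f \<subseteq> carrier K \<times> carrier M" using f(1) by simp
  \<comment> \<open>Unlike the two axioms before it, additivity in the scalar holds only modulo
    \<open>N\<close>, by the first kind of tensor relation.\<close>
  then have "ext (a \<oplus>\<^bsub>K\<^esub> b) f - (ext a f + ext b f) \<in> N"
  proof (induction f rule: frag_induction)
    case (one z)
    obtain c m where z: "z = (c, m)" by (cases z)
    have "frag_of (a * c \<oplus>\<^bsub>K\<^esub> b * c, m) - frag_of (a * c, m) - frag_of (b * c, m) \<in> N"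
      using one z by (intro N_rels) (auto simp: tensor_rels_def)
    then show ?case by (simp add: z distrib_right diff_diff_eq)
  next
    case (diff f g)
    from N_add[OF diff(1) N_minus[OF diff(2)]] show ?case
      by (simp add: frag_extend_diff algebra_simps)
  qed (simp add: N_0)
  then show "(a \<oplus>\<^bsub>K\<^esub> b) \<odot>\<^bsub>V\<^esub> u = a \<odot>\<^bsub>V\<^esub> u \<oplus>\<^bsub>V\<^esub> b \<odot>\<^bsub>V\<^esub> u"
    unfolding f(3) V_smult[OF f(1)] V_simps(3)[OF ext_carrier[OF f(1)] ext_carrier[OF f(1)]] by (rule cl_eqI)
qed

lemma
  assumes "m \<in> carrier M"
  shows pt_carrier: "pt a m \<in> carrier V"
    and pt_smult: "a \<odot>\<^bsub>V\<^esub> pt b m = pt (a * b) m"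
    and pt_add: "l \<in> carrier M \<Longrightarrow> pt a (m \<oplus>\<^bsub>M\<^esub> l) = pt a m \<oplus>\<^bsub>V\<^esub> pt a l"
    and pt_balanced: "pt a (c \<odot>\<^bsub>M\<^esub> m) = pt (a * h c) m"
proof -
  note f = frag_of_carrier[OF assms]
  show "pt a m \<in> carrier V" unfolding pt_cl V_simps(1) using f by (rule imageI)
  show "a \<odot>\<^bsub>V\<^esub> pt b m = pt (a * b) m" unfolding pt_cl V_smult[OF f] by simp
  show "pt a (m \<oplus>\<^bsub>M\<^esub> l) = pt a m \<oplus>\<^bsub>V\<^esub> pt a l" if l: "l \<in> carrier M"
    unfolding pt_cl V_simps(3)[OF f frag_of_carrier[OF l]]
  proof (rule cl_eqI)
    have "frag_of (a, m \<oplus>\<^bsub>M\<^esub> l) - frag_of (a, m) - frag_of (a, l) \<in> N"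
      using assms l by (intro N_rels) (auto simp: tensor_rels_def)
    then show "frag_of (a, m \<oplus>\<^bsub>M\<^esub> l) - (frag_of (a, m) + frag_of (a, l)) \<in> N" by (simp add: diff_diff_eq)
  qed
  have "frag_of (a \<otimes>\<^bsub>K\<^esub> h c, m) - frag_of (a, c \<odot>\<^bsub>M\<^esub> m) \<in> N"
    using assms by (intro N_rels) (auto simp: tensor_rels_def)
  from cl_eqI[OF this] show "pt a (c \<odot>\<^bsub>M\<^esub> m) = pt (a * h c) m" by (simp add: pt_cl)
qed

lemma V_spanned:
  assumes add: "\<And>u v. u \<in> H \<Longrightarrow> v \<in> H \<Longrightarrow> u \<oplus>\<^bsub>V\<^esub> v \<in> H" and smult: "\<And>c u. u \<in> H \<Longrightarrow> c \<odot>\<^bsub>V\<^esub> u \<in> H"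
    and zero: "\<zero>\<^bsub>V\<^esub> \<in> H" and pt: "\<And>a m. m \<in> carrier M \<Longrightarrow> pt a m \<in> H"
  shows "carrier V \<subseteq> H"
proof -
  interpret V: Module.module K V by (rule module_V)
  have "cl f \<in> H" if "f \<in> carrier G" for f
  proof -
    have "Poly_Mapping.keys f \<subseteq> carrier K \<times> carrier M" using that by simp
    then have "f \<in> carrier G \<and> cl f \<in> H"
    proof (induction f rule: frag_induction)
      case zero
      then show ?case using \<open>\<zero>\<^bsub>V\<^esub> \<in> H\<close> by (simp add: V_simps(2))
    next
      case (one z)
      then show ?case using pt[of "snd z" "fst z"] by (auto simp: pt_cl)
    next
      case (diff f g)
      then have f: "f \<in> carrier G" "cl f \<in> H" and g: "g \<in> carrier G" "cl g \<in> H" by blast+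
      have n: "- g \<in> carrier G" using g(1) by simp
      have V: "cl g \<in> carrier V" "cl (- g) \<in> carrier V"
        unfolding V_simps(1) by (rule imageI[OF g(1)], rule imageI[OF n])
      have "cl (- g) \<oplus>\<^bsub>V\<^esub> cl g = \<zero>\<^bsub>V\<^esub>"
        unfolding V_simps(2) V_simps(3)[OF n g(1)] by simp
      then have "\<ominus>\<^bsub>V\<^esub> cl g = cl (- g)" using V by (intro V.minus_equality)
      \<comment> \<open>Closure under negation is obtained from the scalar -1.\<close>
      moreover have "(\<ominus>\<^bsub>K\<^esub> \<one>\<^bsub>K\<^esub>) \<odot>\<^bsub>V\<^esub> cl g = \<ominus>\<^bsub>V\<^esub> cl g"
        by (subst V.smult_l_minus[OF V.R.one_closed V(1)]) (simp only: V.smult_one[OF V(1)])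
      ultimately have "cl (- g) \<in> H" using smult[OF g(2), of "\<ominus>\<^bsub>K\<^esub> \<one>\<^bsub>K\<^esub>"] by (simp only:)
      from add[OF f(2) this] have "cl (f - g) \<in> H" unfolding V_simps(3)[OF f(1) n] by simp
      with carrier_diff[OF f(1) g(1)] show ?case by (rule conjI)
    qed
    then show ?thesis ..
  qed
  then show ?thesis by (auto simp: V_simps(1))
qed

text \<open>The formula a h(L m) is additive in both arguments and balanced over \<open>R\<close>,
  so its extension to formal sums vanishes on the tensor relations.\<close>

lemma extend_functional:
  assumes h: "\<And>a b. h (a + b) = h a + h b" "\<And>a b. h (a * b) = h a * h b"
    and L: "\<And>u v. u \<in> carrier M \<Longrightarrow> v \<in> carrier M \<Longrightarrow> L (u \<oplus>\<^bsub>M\<^esub> v) = L u + L v"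
      "\<And>c u. u \<in> carrier M \<Longrightarrow> L (c \<odot>\<^bsub>M\<^esub> u) = c * L u"
  obtains L' where "\<And>u v. u \<in> carrier V \<Longrightarrow> v \<in> carrier V \<Longrightarrow> L' (u \<oplus>\<^bsub>V\<^esub> v) = L' u + L' v"
    "\<And>c u. u \<in> carrier V \<Longrightarrow> L' (c \<odot>\<^bsub>V\<^esub> u) = c * L' u"
    "\<And>a m. m \<in> carrier M \<Longrightarrow> L' (pt a m) = a * h (L m)"
proof -
  define F where "F f = (\<Sum>z\<in>Poly_Mapping.keys f. of_int (Poly_Mapping.lookup f z) * (fst z * h (L (snd z))))"
    for f :: "'k \<times> 'a \<Rightarrow>\<^sub>0 int"
  have F_add: "F (f + g) = F f + F g" for f g
    unfolding F_def by (rule setsum_keys_plus_distrib) (simp_all add: distrib_right)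
  have F_0: "F 0 = 0" by (simp add: F_def)
  have F_minus: "F (- f) = - F f" for f
    using F_add[of f "- f"] by (simp add: F_0 eq_neg_iff_add_eq_0 add.commute)
  have F_diff: "F (f - g) = F f - F g" for f g
    using F_add[of f "- g"] by (simp add: F_minus)
  have F_of: "F (frag_of z) = fst z * h (L (snd z))" for z
    by (simp add: F_def)
  have F_N: "F f = 0" if "f \<in> N" for f
    using that
  proof (induction f rule: N_induct)
    case (rel f)
    then show ?case unfolding tensor_rels_def
    proof (elim UnE CollectE exE conjE)
      fix b c m assume "f = frag_of (b \<oplus>\<^bsub>K\<^esub> c, m) - frag_of (b, m) - frag_of (c, m)"
      then show ?thesis by (simp only: F_diff F_of) (simp add: distrib_right)
    next
      fix b m l assume "f = frag_of (b, m \<oplus>\<^bsub>M\<^esub> l) - frag_of (b, m) - frag_of (b, l)"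
        "m \<in> carrier M" "l \<in> carrier M"
      then show ?thesis by (simp only: F_diff F_of) (simp add: L h distrib_left)
    next
      fix b c m assume "f = frag_of (b \<otimes>\<^bsub>K\<^esub> h c, m) - frag_of (b, c \<odot>\<^bsub>M\<^esub> m)" "m \<in> carrier M"
      then show ?thesis by (simp only: F_diff F_of) (simp add: L h)
    qed
  qed (simp_all add: F_0 F_add F_minus)
  have F_ext: "F (ext a f) - a * F f = 0" if "f \<in> carrier G" for a f
    by (rule frag_additive_eq[OF that])
      (simp_all add: frag_extend_diff F_diff F_of F_0 algebra_simps)
  \<comment> \<open>The choice of representative is harmless because \<open>F\<close> vanishes on
    \<open>N\<close>.\<close>
  define L' where "L' u = F (SOME f. f \<in> u)" for u
  have L': "L' (cl f) = F f" for f
  proof -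
    have "(SOME g. g \<in> cl f) \<in> cl f"
      by (rule someI[of _ f]) (rule self_in_cl)
    then obtain n where "n \<in> N" "(SOME g. g \<in> cl f) = n + f"
      unfolding cl_eq mem_Collect_eq by (elim exE conjE)
    then show ?thesis by (simp add: L'_def F_add F_N)
  qed
  show ?thesis
  proof (rule that[of L'])
    fix u v c assume u: "u \<in> carrier V"
    then obtain f where f: "f \<in> carrier G" "u = cl f" unfolding V_simps(1) by blast
    show "L' (c \<odot>\<^bsub>V\<^esub> u) = c * L' u"
      using F_ext[OF f(1), of c] unfolding f(2) V_smult[OF f(1)] L' by simp
    assume "v \<in> carrier V"
    then obtain g where g: "g \<in> carrier G" "v = cl g" unfolding V_simps(1) by blast
    show "L' (u \<oplus>\<^bsub>V\<^esub> v) = L' u + L' v"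
      unfolding f(2) g(2) V_simps(3)[OF f(1) g(1)] L' by (rule F_add)
  qed (simp only: pt_cl L' F_of fst_conv snd_conv)
qed

end

section \<open>The basis theorem\<close>

definition proj :: "('n::linorder \<Rightarrow> bit) \<Rightarrow> ('n, 'k::field_char_0) mat_free_alg \<Rightarrow> ('n, 'k) mat_free_alg set"
  where "proj p f = mat_ideal p +>\<^bsub>ring_of_type_algebra\<^esub> f"

lemma proj_eq: "proj p f = {n + f | n. n \<in> mat_ideal p}"
  by (auto simp: proj_def a_r_coset_def r_coset_def)

lemma proj_eqI: "f - g \<in> mat_ideal p \<Longrightarrow> proj p f = proj p g"
proof -
  assume "f - g \<in> mat_ideal p"
  then have "n + (f - g) \<in> mat_ideal p" "n + (g - f) \<in> mat_ideal p" if "n \<in> mat_ideal p" for n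
    using that mat_ideal_add[of n p "f - g"] mat_ideal_add[of n p "- (f - g)"] mat_ideal_minus[of "f - g" p]
    by simp_all
  moreover have "n + f = (n + (f - g)) + g" "n + g = (n + (g - f)) + f" for n by simp_all
  ultimately show ?thesis unfolding proj_eq by blast
qed

lemma proj_eqD:
  assumes "proj p f = proj p g"
  shows "f - g \<in> mat_ideal p"
proof -
  have "f \<in> proj p f" unfolding proj_eq by (rule CollectI, rule exI[of _ 0]) (simp add: mat_ideal_0)
  then obtain n where "n \<in> mat_ideal p" "f = n + g" unfolding assms unfolding proj_eq by blast
  then show ?thesis by simp
qed

lemma F_int_simps:
  fixes p :: "'n::linorder \<Rightarrow> bit"
  shows "carrier (F_int TYPE('k::field_char_0) p) = range (proj p)"
    and "\<zero>\<^bsub>F_int TYPE('k) p\<^esub> = proj p 0" and "\<one>\<^bsub>F_int TYPE('k) p\<^esub> = proj p 1"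
    and "proj p f \<oplus>\<^bsub>F_int TYPE('k) p\<^esub> proj p g = proj p (f + g)"
    and "proj p f \<otimes>\<^bsub>F_int TYPE('k) p\<^esub> proj p g = proj p (f * g)"
    and "c \<odot>\<^bsub>F_int TYPE('k) p\<^esub> proj p f = proj p (fa_const c * f)"
proof -
  interpret ideal "mat_ideal p :: ('n, 'k) mat_free_alg set" ring_of_type_algebra by (rule ideal_mat_ideal)
  have mult: "proj p f \<otimes>\<^bsub>ring_of_type_algebra Quot mat_ideal p\<^esub> proj p g = proj p (f * g)"
    for f g :: "('n, 'k) mat_free_alg"
    using rcoset_mult_add[of f g] by (simp add: FactRing_def proj_def)
  show "carrier (F_int TYPE('k) p) = range (proj p)"
    by (auto simp: F_int_def Let_def FactRing_def A_RCOSETS_def' proj_def)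
  show "\<zero>\<^bsub>F_int TYPE('k) p\<^esub> = proj p 0"
    using proj_eq[of p 0, symmetric] by (simp add: F_int_def Let_def FactRing_def)
  show "\<one>\<^bsub>F_int TYPE('k) p\<^esub> = proj p 1"
    by (simp add: F_int_def Let_def FactRing_def proj_def)
  show "proj p f \<oplus>\<^bsub>F_int TYPE('k) p\<^esub> proj p g = proj p (f + g)"
    using a_rcos_sum[of f g] by (simp add: F_int_def Let_def FactRing_def proj_def)
  show "proj p f \<otimes>\<^bsub>F_int TYPE('k) p\<^esub> proj p g = proj p (f * g)"
    using mult[of f g] by (simp add: F_int_def Let_def)
  show "c \<odot>\<^bsub>F_int TYPE('k) p\<^esub> proj p f = proj p (fa_const c * f)"
    using mult[of "fa_const c" f] by (simp add: F_int_def Let_def proj_def)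
qed

lemma F_int_cases:
  assumes "u \<in> carrier (F_int TYPE('k::field_char_0) p)"
  obtains f where "u = proj p f"
  using assms by (auto simp: F_int_simps)

lemma module_F_int: "Module.module ring_of_type_algebra (F_int TYPE('k::field_char_0) (p :: 'n::linorder \<Rightarrow> bit))"
proof (rule moduleI)
  let ?F = "F_int TYPE('k) p"
  show "cring (ring_of_type_algebra :: ('n, 'k) laurent ring)" by (rule cring_from_type_algebra)
  show "abelian_group ?F"
  proof (rule abelian_groupI)
    fix u assume "u \<in> carrier ?F"
    then obtain f where u: "u = proj p f" by (rule F_int_cases)
    show "\<zero>\<^bsub>?F\<^esub> \<oplus>\<^bsub>?F\<^esub> u = u" by (simp add: u F_int_simps)
    have "proj p (- f) \<oplus>\<^bsub>?F\<^esub> u = \<zero>\<^bsub>?F\<^esub>" by (simp add: u F_int_simps)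
    then show "\<exists>v\<in>carrier ?F. v \<oplus>\<^bsub>?F\<^esub> u = \<zero>\<^bsub>?F\<^esub>" by (auto simp: F_int_simps(1))
  qed (auto simp: F_int_simps ac_simps elim!: F_int_cases)
qed (auto simp: F_int_simps fa_const_simps distrib_left distrib_right mult.assoc elim!: F_int_cases)

lemma ordered_monomial_word: "ordered_monomial TYPE('k::field_char_0) p r e = proj p (word (mono_word r e))"
proof -
  have gen: "F_gen TYPE('k) p g = proj p (word [g])" for g
    by (simp add: F_gen_def proj_def fa_gen_word)
  have pow: "F_gen TYPE('k) p g [^]\<^bsub>F_int TYPE('k) p\<^esub> n = proj p (word (replicate n g))" for g and n :: nat
  proof (induction n)
    case (Suc n)
    then show ?case
      by (simp add: nat_pow_def gen F_int_simps flip: word_append replicate_append_same)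
  qed (simp add: nat_pow_def F_int_simps word_Nil)
  have "foldr (\<lambda>g m. (F_gen TYPE('k) p g [^]\<^bsub>F_int TYPE('k) p\<^esub> e g) \<otimes>\<^bsub>F_int TYPE('k) p\<^esub> m) gs \<one>\<^bsub>F_int TYPE('k) p\<^esub>
    = proj p (word (concat (map (\<lambda>g. replicate (e g) g) gs)))" for gs
    by (induction gs) (simp_all add: pow F_int_simps word_Nil word_append)
  then show ?thesis by (simp add: ordered_monomial_def mono_word_def)
qed

lemma laurent_emb_0: "laurent_emb 0 = 0"
  by (simp add: laurent_emb_def Zero_fract_def)

lemma laurent_emb_simps:
  "laurent_emb (a + b) = laurent_emb a + laurent_emb b" "laurent_emb (a * b) = laurent_emb a * laurent_emb b"
  "laurent_emb a = 0 \<longleftrightarrow> a = 0"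
  by (simp_all add: laurent_emb_def Zero_fract_def eq_fract)

theorem theorem4p3p5:
  fixes p :: "'n::{finite, linorder} \<Rightarrow> bit"
    and r :: "(('n \<times> 'n) \<times> ('n \<times> 'n)) set"
  assumes "CARD('n) \<ge> 2"
    and "linear_order r"
  shows "module_basis (laurent_ring TYPE('n) TYPE('k::field_char_0)) (F_int TYPE('k) p)
           (truncated_monomials TYPE('k) p r)
       \<and> inj_on (ordered_monomial TYPE('k) p r) (truncated_exponents p)
       \<and> free_module (laurent_ring TYPE('n) TYPE('k)) (F_int TYPE('k) p)
       \<and> vectorspace (laurent_field TYPE('n) TYPE('k)) (F_frac TYPE('k) p)
       \<and> vectorspace.basis (laurent_field TYPE('n) TYPE('k)) (F_frac TYPE('k) p)
           (F_base TYPE('k) p ` truncated_monomials TYPE('k) p r)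
       \<and> inj_on (F_base TYPE('k) p) (truncated_monomials TYPE('k) p r)"
proof -
  let ?F = "F_int TYPE('k) p" and ?E = "truncated_exponents p" and ?x = "ordered_monomial TYPE('k) p r"
  let ?R = "ring_of_type_algebra :: ('n, 'k) laurent ring"
  let ?K = "ring_of_type_algebra :: ('n, 'k) laurent fract ring"
  obtain \<phi> :: "('n, 'k) mat_free_alg \<Rightarrow> ('n \<times> 'n \<Rightarrow> nat) \<Rightarrow> ('n, 'k) laurent" where
    \<phi>_add: "\<And>f g e. \<phi> (f + g) e = \<phi> f e + \<phi> g e" and
    \<phi>_scale: "\<And>c f e. \<phi> (fa_const c * f) e = c * \<phi> f e" and
    \<phi>_ideal: "\<And>f e. f \<in> mat_ideal p \<Longrightarrow> \<phi> f e = 0" and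
    \<phi>_zero: "\<And>w e. e \<in> ?E \<Longrightarrow> word_wt w \<le> exp_wt e \<Longrightarrow> e \<noteq> count_list w \<Longrightarrow>
      \<phi> (Poly_Mapping.single (Wd w) 1) e = 0" and
    \<phi>_unit: "\<And>w. count_list w \<in> ?E \<Longrightarrow> \<phi> (Poly_Mapping.single (Wd w) 1) (count_list w) dvd 1"
    by (rule eval_functional_exists[of p, where ?'k = 'k]) (rule that, assumption+)
  \<comment> \<open>The functional descends to the quotient because \<phi> vanishes on the
    ideal.\<close>
  define L where "L e u = \<phi> (SOME f. u = proj p f) e" for e u
  have L: "L e (proj p f) = \<phi> f e" for e f
  proof -
    have "proj p f = proj p (SOME g. proj p f = proj p g)" by (rule someI) (rule refl)
    from proj_eqD[OF this] have "f - (SOME g. proj p f = proj p g) \<in> mat_ideal p" .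
    from \<phi>_add[of "f - (SOME g. proj p f = proj p g)" "SOME g. proj p f = proj p g" e] \<phi>_ideal[OF this, of e]
    show ?thesis by (simp add: L_def)
  qed
  note count = count_mono_word[OF assms(2)]
  have wt: "word_wt (mono_word r e) = exp_wt e" for e
    using exp_wt_count[of "mono_word r e"] by (simp add: count)
  have diag: "L e (?x e) \<noteq> 0" if "e \<in> ?E" for e
    using \<phi>_unit[of "mono_word r e"] that by (auto simp: ordered_monomial_word L count word_def)
  have triangular: "L e (?x e') = 0" if "e \<in> ?E" "e \<noteq> e'" "exp_wt e' \<le> exp_wt e" for e e'
    using \<phi>_zero[of e "mono_word r e'"] that by (simp add: ordered_monomial_word L count wt word_def)
  have L_add: "L e (u \<oplus>\<^bsub>?F\<^esub> v) = L e u + L e v" if "u \<in> carrier ?F" "v \<in> carrier ?F" for e u v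
    using that by (auto simp: F_int_simps L \<phi>_add elim!: F_int_cases)
  have L_smult: "L e (c \<odot>\<^bsub>?F\<^esub> u) = c * L e u" if "u \<in> carrier ?F" for e c u
    using that by (auto simp: F_int_simps L \<phi>_scale elim!: F_int_cases)
  have x: "?x e \<in> carrier ?F" for e
    by (simp add: ordered_monomial_word F_int_simps)
  have spanning: "carrier ?F \<subseteq> H"
    if add: "\<And>u v. u \<in> H \<Longrightarrow> v \<in> H \<Longrightarrow> u \<oplus>\<^bsub>?F\<^esub> v \<in> H" and smult: "\<And>c u. u \<in> H \<Longrightarrow> c \<odot>\<^bsub>?F\<^esub> u \<in> H"
      and zero: "\<zero>\<^bsub>?F\<^esub> \<in> H" and mono: "\<And>e. e \<in> ?E \<Longrightarrow> ?x e \<in> H" for H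
  proof -
    \<comment> \<open>\<open>words_span\<close> is applied to the preimage of \<open>H\<close> under
      the quotient map.\<close>
    have "f \<in> {f. proj p f \<in> H}" for f
    proof (rule words_span[OF assms(2)])
      show "mat_ideal p \<subseteq> {f. proj p f \<in> H}"
      proof
        fix f :: "('n, 'k) mat_free_alg" assume "f \<in> mat_ideal p"
        then have "proj p f = proj p 0" by (intro proj_eqI) simp
        then show "f \<in> {f. proj p f \<in> H}" using zero by (simp add: F_int_simps)
      qed
      show "f + g \<in> {f. proj p f \<in> H}" if "f \<in> {f. proj p f \<in> H}" "g \<in> {f. proj p f \<in> H}" for f g
        using add[of "proj p f" "proj p g"] that by (simp add: F_int_simps)
      show "fa_const c * f \<in> {f. proj p f \<in> H}" if "f \<in> {f. proj p f \<in> H}" for c f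
        using smult[of "proj p f" c] that by (simp add: F_int_simps)
      show "word (mono_word r e) \<in> {f. proj p f \<in> H}" if "e \<in> ?E" for e
        using mono[OF that] by (simp add: ordered_monomial_word)
    qed
    then show ?thesis by (auto simp: F_int_simps)
  qed
  note F = triangular_basis[of ?F ?E ?x L exp_wt, OF module_F_int x L_add L_smult diag triangular spanning]
  have inj: "inj_on ?x ?E" and basis: "module_basis ?R ?F (?x ` ?E)"
    by (rule F; assumption)+
  interpret S: scalar_extension "laurent_emb :: ('n, 'k) laurent \<Rightarrow> _" ?F
    by (rule scalar_extension.intro, rule module_F_int)
  let ?V = "S.V"
  let ?y = "\<lambda>e. S.pt 1 (?x e)"
  interpret V: Module.module ?K ?V by (rule S.module_V)
  \<comment> \<open>The properties are bundled so that one choice gives extended functionals for all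
    exponents.\<close>
  let ?P = "\<lambda>e L'. (\<forall>u\<in>carrier ?V. \<forall>v\<in>carrier ?V. L' (u \<oplus>\<^bsub>?V\<^esub> v) = L' u + L' v)
      \<and> (\<forall>c. \<forall>u\<in>carrier ?V. L' (c \<odot>\<^bsub>?V\<^esub> u) = c * L' u)
      \<and> (\<forall>a. \<forall>m\<in>carrier ?F. L' (S.pt a m) = a * laurent_emb (L e m))"
  have "\<exists>L'. ?P e L'" for e
    by (rule S.extend_functional[where L = "L e", OF laurent_emb_simps(1,2) L_add L_smult]; (assumption | blast)?)
  then have "\<forall>e. \<exists>L'. ?P e L'" by (rule allI)
  from choice[OF this] obtain L' where "\<forall>e. ?P e (L' e)" by (rule exE)
  then have L': "\<And>e u v. u \<in> carrier ?V \<Longrightarrow> v \<in> carrier ?V \<Longrightarrow> L' e (u \<oplus>\<^bsub>?V\<^esub> v) = L' e u + L' e v"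
    "\<And>e c u. u \<in> carrier ?V \<Longrightarrow> L' e (c \<odot>\<^bsub>?V\<^esub> u) = c * L' e u"
    "\<And>e a m. m \<in> carrier ?F \<Longrightarrow> L' e (S.pt a m) = a * laurent_emb (L e m)"
    by blast+
  have V_spanning: "carrier ?V \<subseteq> H"
    if add: "\<And>u v. u \<in> H \<Longrightarrow> v \<in> H \<Longrightarrow> u \<oplus>\<^bsub>?V\<^esub> v \<in> H" and smult: "\<And>c u. u \<in> H \<Longrightarrow> c \<odot>\<^bsub>?V\<^esub> u \<in> H"
      and zero: "\<zero>\<^bsub>?V\<^esub> \<in> H" and mono: "\<And>e. e \<in> ?E \<Longrightarrow> ?y e \<in> H" for H
  proof (rule S.V_spanned)
    \<comment> \<open>Spanning is reduced to the integral form: \<open>?H\<close> consists of those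
      m all of whose pure tensors lie in \<open>H\<close>. It is closed under the module operations
      and contains the monomials, since a tensor m is a times 1 tensor m.\<close>
    let ?H = "{m \<in> carrier ?F. \<forall>a. S.pt a m \<in> H}"
    have F0: "\<zero>\<^bsub>?F\<^esub> \<in> carrier ?F" by (rule S.M.zero_closed)
    have "carrier ?F \<subseteq> ?H"
    proof (rule spanning)
      show "u \<oplus>\<^bsub>?F\<^esub> v \<in> ?H" if "u \<in> ?H" "v \<in> ?H" for u v
        using that add by (auto simp: S.pt_add)
      show "c \<odot>\<^bsub>?F\<^esub> u \<in> ?H" if "u \<in> ?H" for c u
        using that by (auto simp: S.pt_balanced)
      have "S.pt a \<zero>\<^bsub>?F\<^esub> \<in> H" for a
      proof -
        have "S.pt a \<zero>\<^bsub>?F\<^esub> = S.pt a (0 \<odot>\<^bsub>?F\<^esub> \<zero>\<^bsub>?F\<^esub>)" using S.M.smult_r_null[of 0] by simp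
        also have "\<dots> = \<zero>\<^bsub>?K\<^esub> \<odot>\<^bsub>?V\<^esub> S.pt a \<zero>\<^bsub>?F\<^esub>"
          unfolding S.pt_balanced[OF F0] S.pt_smult[OF F0] by (simp add: laurent_emb_0)
        also have "\<dots> = \<zero>\<^bsub>?V\<^esub>" by (rule V.smult_l_null[OF S.pt_carrier[OF F0]])
        finally show ?thesis using zero by simp
      qed
      then show "\<zero>\<^bsub>?F\<^esub> \<in> ?H" using F0 by simp
      show "?x e \<in> ?H" if "e \<in> ?E" for e
        using smult[OF mono[OF that]] x by (simp add: S.pt_smult)
    qed
    then show "S.pt a m \<in> H" if "m \<in> carrier ?F" for a m using that by blast
  qed (use add smult zero in blast)+
  \<comment> \<open>The value of L' e on 1 tensor x is the image of L e x, so triangularity is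
    inherited, and the diagonal stays nonzero because \<open>laurent_emb\<close> is
    injective.\<close>
  have "inj_on ?y ?E" and V_basis: "module_basis ?K ?V (?y ` ?E)"
    by (rule triangular_basis[of ?V ?E ?y L' exp_wt, OF S.module_V S.pt_carrier[OF x] L'(1,2) _ _ V_spanning];
        simp add: L'(3) x laurent_emb_simps(3) laurent_emb_0 diag triangular)+
  have F_base: "F_base TYPE('k) p (?x e) = ?y e" for e
    by (simp add: F_base_def laurent_ring_def laurent_field_def)
  have V: "F_frac TYPE('k) p = ?V"
    by (simp add: F_frac_def laurent_ring_def laurent_field_def)
  have vs: "vectorspace ?K ?V"
    by (rule vectorspace.intro[OF S.module_V field_from_type_algebra])
  have "vectorspace.basis ?K ?V (?y ` ?E)"
    using V_basis unfolding vectorspace.basis_def[OF vs] module_basis_def by blast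
  moreover have "F_base TYPE('k) p ` ?x ` ?E = ?y ` ?E"
    by (simp add: image_image F_base)
  moreover have "inj_on (F_base TYPE('k) p) (?x ` ?E)"
    using \<open>inj_on ?y ?E\<close> by (auto simp: inj_on_def F_base)
  ultimately show ?thesis
    using basis inj vs unfolding truncated_monomials_def free_module_def V
    by (auto simp: laurent_ring_def laurent_field_def)
qed

end
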